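(* One has $MaxDim(HS)\ge 6$ and $MaxDim(McL)\ge 6$.
   Context: For a finite group $G$: a list of subgroups $\{H_1,\dots,H_n\}$ of $G$ is in general position if for every $i\in\{1,\dots,n\}$ one has $\bigcap_{j\neq i} H_j \supsetneq \bigcap_{j} H_j$ (an empty intersection is taken to be $G$). $MaxDim(G)$ is the maximal size of a list of maximal subgroups of $G$ in general position. $HS$ is the Higman--Sims sporadic simple group and $McL$ is the McLaughlin sporadic simple group. *)

theory Defs
  imports "HOL-Algebra.Algebra"
begin

section \<open>Maximal subgroups in general position\<close>

definition maximal_subgroup :: "'a set \<Rightarrow> ('a, 'b) monoid_scheme \<Rightarrow> bool" where
  "maximal_subgroup H G \<longleftrightarrow>
     subgroup H G \<and> H \<noteq> carrier G \<and>
     (\<forall>K. subgroup K G \<and> H \<subseteq> K \<longrightarrow> K = H \<or> K = carrier G)"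

text \<open>Intersecting with the carrier implements the convention that an empty intersection is
  the whole group.\<close>

definition general_position :: "('a, 'b) monoid_scheme \<Rightarrow> 'a set list \<Rightarrow> bool" where
  "general_position G Hs \<longleftrightarrow>
     (\<forall>i<length Hs.
        carrier G \<inter> (\<Inter>j\<in>{..<length Hs}. Hs ! j)
        \<subset> carrier G \<inter> (\<Inter>j\<in>{..<length Hs} - {i}. Hs ! j))"

text \<open>For a finite group the maximum is over a finite nonempty set, see
  \<open>finite_MaxDim_set\<close> and \<open>MaxDim_set_nonempty\<close> below.\<close>

definition MaxDim :: "('a, 'b) monoid_scheme \<Rightarrow> nat" where
  "MaxDim G =
     Max {length Hs | Hs. (\<forall>H\<in>set Hs. maximal_subgroup H G) \<and> general_position G Hs}"

lemma general_position_distinct: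
  assumes "general_position G Hs"
  shows "distinct Hs"
proof -
  have False if "i < length Hs" "k < length Hs" "i \<noteq> k" "Hs ! i = Hs ! k" for i k
  proof -
    have "(\<Inter>j\<in>{..<length Hs} - {i}. Hs ! j) \<subseteq> (\<Inter>j\<in>{..<length Hs}. Hs ! j)"
    proof
      fix x assume x: "x \<in> (\<Inter>j\<in>{..<length Hs} - {i}. Hs ! j)"
      have "x \<in> Hs ! j" if "j < length Hs" for j
        using x that \<open>k < length Hs\<close> \<open>i \<noteq> k\<close> \<open>Hs ! i = Hs ! k\<close> by (cases "j = i") auto
      then show "x \<in> (\<Inter>j\<in>{..<length Hs}. Hs ! j)" by simp
    qed
    then show False
      using assms[unfolded general_position_def, rule_format, OF \<open>i < length Hs\<close>]
      by (meson Int_mono dual_order.refl leD)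
  qed
  then show ?thesis
    by (meson distinct_conv_nth)
qed

lemma finite_MaxDim_set:
  assumes "finite (carrier G)"
  shows "finite {length Hs | Hs. (\<forall>H\<in>set Hs. maximal_subgroup H G) \<and> general_position G Hs}"
    (is "finite ?S")
proof (rule finite_subset)
  show "?S \<subseteq> {..card (Pow (carrier G))}"
  proof
    fix n assume "n \<in> ?S"
    then have "\<exists>Hs. n = length Hs \<and> (\<forall>H\<in>set Hs. maximal_subgroup H G) \<and> general_position G Hs"
      by (rule CollectD)
    then obtain Hs where Hs: "n = length Hs" "\<forall>H\<in>set Hs. maximal_subgroup H G"
      "general_position G Hs"
      by (elim exE conjE)
    have "set Hs \<subseteq> Pow (carrier G)"
    proof
      fix H assume "H \<in> set Hs"
      with Hs(2) have "maximal_subgroup H G" by (rule bspec)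
      then have "subgroup H G" by (simp only: maximal_subgroup_def)
      then show "H \<in> Pow (carrier G)" by (intro PowI subgroup.subset)
    qed
    then have "card (set Hs) \<le> card (Pow (carrier G))"
      using assms by (intro card_mono finite_Pow_iff[THEN iffD2])
    then show "n \<in> {..card (Pow (carrier G))}"
      using Hs(1) distinct_card[OF general_position_distinct[OF Hs(3)]] by simp
  qed
qed simp

lemma MaxDim_set_nonempty:
  fixes G :: "('a, 'b) monoid_scheme"
  shows "{length Hs | Hs. (\<forall>H\<in>set Hs. maximal_subgroup H G) \<and> general_position G Hs} \<noteq> {}"
proof -
  have "general_position G []"
    by (simp add: general_position_def)
  then have "length ([] :: 'a set list) \<in>
      {length Hs | Hs. (\<forall>H\<in>set Hs. maximal_subgroup H G) \<and> general_position G Hs}"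
    by (intro CollectI exI[of _ "[]"]) simp
  then show ?thesis by (metis emptyE)
qed


section \<open>Automorphism groups of graphs\<close>

definition graph_aut :: "'v set \<Rightarrow> ('v \<Rightarrow> 'v \<Rightarrow> bool) \<Rightarrow> ('v \<Rightarrow> 'v) monoid" where
  "graph_aut V adj =
     (BijGroup V)\<lparr>carrier := {f \<in> Bij V. \<forall>x\<in>V. \<forall>y\<in>V. adj (f x) (f y) \<longleftrightarrow> adj x y}\<rparr>"

definition derived_group :: "('a, 'b) monoid_scheme \<Rightarrow> ('a, 'b) monoid_scheme" where
  "derived_group G = G\<lparr>carrier := derived G (carrier G)\<rparr>"

lemma subgroup_graph_aut: "subgroup (carrier (graph_aut V adj)) (BijGroup V)"
proof -
  interpret group "BijGroup V" by (rule group_BijGroup)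
  show ?thesis
  proof (rule subgroupI)
    show "carrier (graph_aut V adj) \<subseteq> carrier (BijGroup V)"
      by (auto simp: graph_aut_def BijGroup_def)
    have "(\<lambda>x\<in>V. x) \<in> carrier (graph_aut V adj)"
      by (auto simp: graph_aut_def id_Bij)
    then show "carrier (graph_aut V adj) \<noteq> {}" by blast
  next
    fix f assume "f \<in> carrier (graph_aut V adj)"
    then have f: "f \<in> Bij V" "\<And>x y. x \<in> V \<Longrightarrow> y \<in> V \<Longrightarrow> adj (f x) (f y) \<longleftrightarrow> adj x y"
      by (auto simp: graph_aut_def)
    have img: "f ` V = V" using f(1) by (auto simp: Bij_def bij_betw_def)
    have "adj (inv_into V f x) (inv_into V f y) \<longleftrightarrow> adj x y" if "x \<in> V" "y \<in> V" for x y
      using f(2)[of "inv_into V f x" "inv_into V f y"] that img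
      by (simp add: f_inv_into_f inv_into_into)
    then show "inv\<^bsub>BijGroup V\<^esub> f \<in> carrier (graph_aut V adj)"
      using f(1) by (simp add: inv_BijGroup graph_aut_def restrict_inv_into_Bij)
  next
    fix f g assume "f \<in> carrier (graph_aut V adj)" "g \<in> carrier (graph_aut V adj)"
    then have fg: "f \<in> Bij V" "g \<in> Bij V"
      "\<And>x y. x \<in> V \<Longrightarrow> y \<in> V \<Longrightarrow> adj (f x) (f y) \<longleftrightarrow> adj x y"
      "\<And>x y. x \<in> V \<Longrightarrow> y \<in> V \<Longrightarrow> adj (g x) (g y) \<longleftrightarrow> adj x y"
      by (simp_all add: graph_aut_def)
    have "g x \<in> V" if "x \<in> V" for x
      using Bij_imp_funcset[OF fg(2)] that by (rule funcset_mem)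
    with fg have "compose V f g \<in> carrier (graph_aut V adj)"
      by (simp add: graph_aut_def compose_Bij compose_eq)
    with fg(1,2) show "f \<otimes>\<^bsub>BijGroup V\<^esub> g \<in> carrier (graph_aut V adj)"
      by (simp add: BijGroup_def)
  qed
qed

lemma group_graph_aut: "group (graph_aut V adj)"
  using group.subgroup_imp_group[OF group_BijGroup subgroup_graph_aut[of V adj]]
  by (simp add: graph_aut_def)

lemma (in group) group_derived_group: "group (derived_group G)"
  unfolding derived_group_def
  by (intro subgroup_imp_group derived_is_subgroup) simp


section \<open>The Steiner systems S(4,7,23) and S(3,6,22)\<close>

text \<open>The binary Golay code of length 23, as the quadratic residue code modulo 23: the words are
  subsets of \<open>{0..<23}\<close>, and the code is the \<open>GF(2)\<close>-span of the translates of the set of nonzero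
  squares modulo 23. It has 4096 words; the 253 words of weight 7 are the blocks of S(4,7,23).\<close>

inductive_set golay_code :: "nat set set" where
  zero: "{} \<in> golay_code"
| add: "W \<in> golay_code \<Longrightarrow> sym_diff W ((\<lambda>k. (k ^ 2 + i) mod 23) ` {1..22}) \<in> golay_code"

definition S4723 :: "nat set set" where
  "S4723 = {B \<in> golay_code. card B = 7}"

text \<open>The derived design of S(4,7,23) at the point 0, on the points \<open>{1..22}\<close>; it has 77 blocks.\<close>

definition S3622 :: "nat set set" where
  "S3622 = (\<lambda>B. B - {0}) ` {B \<in> S4723. 0 \<in> B}"


section \<open>The Higman--Sims and McLaughlin groups\<close>

datatype vertex = Infinity | Point nat | Block "nat set"

text \<open>The Higman--Sims graph, the strongly regular graph with parameters (100, 22, 0, 6).\<close>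

definition HS_vertices :: "vertex set" where
  "HS_vertices = {Infinity} \<union> Point ` {1..22} \<union> Block ` S3622"

fun HS_adj :: "vertex \<Rightarrow> vertex \<Rightarrow> bool" where
  "HS_adj Infinity (Point p) = True"
| "HS_adj (Point p) Infinity = True"
| "HS_adj (Point p) (Block B) = (p \<in> B)"
| "HS_adj (Block B) (Point p) = (p \<in> B)"
| "HS_adj (Block B) (Block C) = (B \<inter> C = {})"
| "HS_adj _ _ = False"

text \<open>The full automorphism group is HS:2; its derived subgroup is its unique subgroup of
  index 2, of order 44352000.\<close>

definition HS :: "(vertex \<Rightarrow> vertex) monoid" where
  "HS = derived_group (graph_aut HS_vertices HS_adj)"

text \<open>The McLaughlin graph, the strongly regular graph with parameters (275, 112, 30, 56). The
  point 0 of S(4,7,23) is distinguished: it splits the 253 blocks into 77 + 176 and is not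
  itself a vertex. A point is adjacent to the blocks through 0 that avoid it and to the blocks
  avoiding 0 that contain it.\<close>

definition McL_vertices :: "vertex set" where
  "McL_vertices = Point ` {1..22} \<union> Block ` S4723"

fun McL_adj :: "vertex \<Rightarrow> vertex \<Rightarrow> bool" where
  "McL_adj (Point p) (Block B) = ((p \<in> B) \<noteq> (0 \<in> B))"
| "McL_adj (Block B) (Point p) = ((p \<in> B) \<noteq> (0 \<in> B))"
| "McL_adj (Block B) (Block C) =
     (card (B \<inter> C) = (if (0 \<in> B) = (0 \<in> C) then 1 else 3))"
| "McL_adj _ _ = False"

text \<open>The full automorphism group is McL:2; its derived subgroup is its unique subgroup of
  index 2, of order 898128000.\<close>

definition McL :: "(vertex \<Rightarrow> vertex) monoid" where
  "McL = derived_group (graph_aut McL_vertices McL_adj)"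

end

theory Submission
  imports Defs
begin

text \<open>The stabilisers of six vertices of the defining graphs are maximal subgroups in general position.

  Maximality. Both groups act on their graphs as rank three groups: they are transitive, and a vertex
  stabiliser is transitive on the neighbours and on the non-neighbours of its vertex. A group strictly
  containing the stabiliser then has an orbit containing all neighbours or all non-neighbours of the
  vertex, and the graph and its complement are connected, so that orbit is the whole graph
  (\<open>maximal_stab\<close>). For transitivity it is enough to know a few elements. The Mathieu group \<open>M\<^bsub>22\<^esub>\<close>, the
  permutations of 22 points that preserve the Golay code, acts on both graphs. It is not transitive,
  but each graph has one more visible automorphism, which comes from a polarity of the projective plane
  of order 4. The polarity may lie outside the derived group. The conjugate of an element of the derived
  group by it does not, and such conjugates join the orbits of \<open>M\<^bsub>22\<^esub>\<close> (\<open>fused_conjugate\<close>).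

  General position. Six vertices are needed such that for each of them some group element moves it and
  fixes the other five (\<open>general_position_stab\<close>). Points and hexads are vertices of both graphs, and \<open>M\<^bsub>22\<^esub>\<close>
  already has enough elements: for three points and three hexads, each hexad through two of the points,
  there are an involution moving only one of the points and an element of order 3 moving only one of the
  hexads, and an element of \<open>M\<^bsub>22\<^esub>\<close> permutes the six cyclically by type
  (\<open>triangle_moved_alone\<close>). Hence one argument serves both groups.

  The elements used are written as tables and checked by rewriting with binary numerals, a set of points
  being coded by the digits of a number. That they act as elements of the derived group holds because
  they are commutators in \<open>M\<^bsub>22\<^esub>\<close> (\<open>commutators\<close>). Completeness of the list of blocks comes from an
  inspection of all 4096 words of the code (\<open>weight_seven_is_block\<close>).\<close>

section \<open>Rank three groups and general position of stabilisers\<close>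

lemma MaxDim_ge:
  assumes "finite (carrier G)" "\<forall>H\<in>set Hs. maximal_subgroup H G" "general_position G Hs"
  shows "length Hs \<le> MaxDim G"
  unfolding MaxDim_def
  by (rule Max_ge[OF finite_MaxDim_set[OF assms(1)]]) (use assms(2,3) in blast)

text \<open>Vertices are permuted by the extensional bijections that make up the automorphism group of the
  graph. The first lemmas turn the group operations into statements about the images of
  vertices.\<close>

locale finite_graph =
  fixes V :: "'v set" and adj :: "'v \<Rightarrow> 'v \<Rightarrow> bool"
  assumes finite_vertices: "finite V"
begin

abbreviation "Aut \<equiv> graph_aut V adj"
abbreviation "Aut' \<equiv> derived_group Aut"

sublocale Aut: group Aut
  by (rule group_graph_aut)

sublocale Aut': group Aut'
  by (rule Aut.group_derived_group)

lemma mem_Aut_iff: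
  "f \<in> carrier Aut \<longleftrightarrow>
     f \<in> extensional V \<and> bij_betw f V V \<and> (\<forall>x\<in>V. \<forall>y\<in>V. adj (f x) (f y) \<longleftrightarrow> adj x y)"
  by (auto simp: graph_aut_def Bij_def)

lemma Aut_closed: "f \<in> carrier Aut \<Longrightarrow> x \<in> V \<Longrightarrow> f x \<in> V"
  by (auto simp: mem_Aut_iff dest: bij_betwE)

lemma Aut_eqI:
  "f \<in> carrier Aut \<Longrightarrow> g \<in> carrier Aut \<Longrightarrow> (\<And>x. x \<in> V \<Longrightarrow> f x = g x) \<Longrightarrow> f = g"
  by (auto simp: mem_Aut_iff intro: extensionalityI)

lemma Aut_mult:
  assumes "f \<in> carrier Aut" "g \<in> carrier Aut" "x \<in> V"
  shows "(f \<otimes>\<^bsub>Aut\<^esub> g) x = f (g x)"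
  using assms by (simp add: graph_aut_def BijGroup_def compose_def)

lemma Aut_one: "x \<in> V \<Longrightarrow> \<one>\<^bsub>Aut\<^esub> x = x"
  by (simp add: graph_aut_def BijGroup_def)

lemma Aut_inv:
  assumes "f \<in> carrier Aut" "x \<in> V"
  shows "(inv\<^bsub>Aut\<^esub> f) (f x) = x"
  using Aut_mult[of "inv\<^bsub>Aut\<^esub> f" f x] assms by (simp add: Aut_one)

lemma derived_subgroup: "subgroup (carrier Aut') Aut"
  by (simp add: derived_group_def Aut.derived_is_subgroup)

lemma derived_mem_Aut: "g \<in> carrier Aut' \<Longrightarrow> g \<in> carrier Aut"
  using subgroup.subset[OF derived_subgroup] by blast

lemma derived_mult:
  "g \<in> carrier Aut' \<Longrightarrow> h \<in> carrier Aut' \<Longrightarrow> x \<in> V \<Longrightarrow> (g \<otimes>\<^bsub>Aut'\<^esub> h) x = g (h x)"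
  using Aut_mult[OF derived_mem_Aut derived_mem_Aut, of g h x] by (simp add: derived_group_def)

lemma derived_one: "x \<in> V \<Longrightarrow> \<one>\<^bsub>Aut'\<^esub> x = x"
  by (simp add: derived_group_def Aut_one)

lemma derived_inv: "g \<in> carrier Aut' \<Longrightarrow> x \<in> V \<Longrightarrow> (inv\<^bsub>Aut'\<^esub> g) (g x) = x"
  using derived_mult[of "inv\<^bsub>Aut'\<^esub> g" g x] by (simp add: derived_one)

lemma derived_closed: "g \<in> carrier Aut' \<Longrightarrow> x \<in> V \<Longrightarrow> g x \<in> V"
  by (rule Aut_closed[OF derived_mem_Aut])

lemma derived_adj: "g \<in> carrier Aut' \<Longrightarrow> x \<in> V \<Longrightarrow> y \<in> V \<Longrightarrow> adj (g x) (g y) \<longleftrightarrow> adj x y"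
  using derived_mem_Aut[of g] by (simp add: mem_Aut_iff)

lemma derived_inj: "g \<in> carrier Aut' \<Longrightarrow> x \<in> V \<Longrightarrow> y \<in> V \<Longrightarrow> g x = g y \<longleftrightarrow> x = y"
  by (metis derived_inv)

lemma finite_derived: "finite (carrier Aut')"
proof (rule finite_subset)
  show "carrier Aut' \<subseteq> V \<rightarrow>\<^sub>E V"
    using derived_mem_Aut by (auto simp: PiE_def mem_Aut_iff dest: bij_betwE)
qed (simp add: finite_PiE finite_vertices)

text \<open>The hypothesis says that \<open>w\<close> is the commutator \<open>f g f\<inverse> g\<inverse>\<close>, in a form without inverses that can be
  checked on tables of images.\<close>

lemma commutator_mem_derived:
  assumes "f \<in> carrier Aut" "g \<in> carrier Aut" "w \<in> carrier Aut"
    and "\<And>x. x \<in> V \<Longrightarrow> w (g (f x)) = f (g x)"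
  shows "w \<in> carrier Aut'"
proof -
  have "w \<otimes>\<^bsub>Aut\<^esub> g \<otimes>\<^bsub>Aut\<^esub> f = f \<otimes>\<^bsub>Aut\<^esub> g"
    using assms by (intro Aut_eqI) (simp_all add: Aut_mult Aut_closed)
  then have "w = f \<otimes>\<^bsub>Aut\<^esub> g \<otimes>\<^bsub>Aut\<^esub> inv\<^bsub>Aut\<^esub> f \<otimes>\<^bsub>Aut\<^esub> inv\<^bsub>Aut\<^esub> g"
    using assms(1-3) by (metis Aut.inv_solve_right' Aut.m_closed)
  then show ?thesis
    using assms(1,2) unfolding derived_group_def derived_def
    by (auto intro!: generate.incl)
qed

text \<open>Being in one orbit of the pointwise stabiliser of \<open>S\<close> in the derived group; for \<open>S = {}\<close> in one orbit of
  the derived group itself.\<close>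

definition fused :: "'v set \<Rightarrow> 'v \<Rightarrow> 'v \<Rightarrow> bool" where
  "fused S x y \<longleftrightarrow> x \<in> V \<and> (\<exists>g\<in>carrier Aut'. (\<forall>s\<in>S. g s = s) \<and> g x = y)"

lemma fusedI: "g \<in> carrier Aut' \<Longrightarrow> (\<And>s. s \<in> S \<Longrightarrow> g s = s) \<Longrightarrow> x \<in> V \<Longrightarrow> g x = y \<Longrightarrow> fused S x y"
  unfolding fused_def by blast

lemma fused_trans:
  assumes "S \<subseteq> V" "fused S x y" "fused S y z"
  shows "fused S x z"
proof -
  from assms obtain g h where "g \<in> carrier Aut'" "\<forall>s\<in>S. g s = s" "g x = y" "x \<in> V"
    "h \<in> carrier Aut'" "\<forall>s\<in>S. h s = s" "h y = z"
    unfolding fused_def by blast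
  with assms(1) show ?thesis
    by (intro fusedI[of "h \<otimes>\<^bsub>Aut'\<^esub> g"]) (auto simp: derived_mult)
qed

lemma fused_sym:
  assumes "S \<subseteq> V" "fused S x y"
  shows "fused S y x"
proof -
  from assms obtain g where g: "g \<in> carrier Aut'" "\<forall>s\<in>S. g s = s" "g x = y" "x \<in> V"
    unfolding fused_def by blast
  have "(inv\<^bsub>Aut'\<^esub> g) s = s" if "s \<in> S" for s
    using derived_inv[OF g(1), of s] g(2) assms(1) that by auto
  with g derived_inv[OF g(1,4)] show ?thesis
    by (intro fusedI[of "inv\<^bsub>Aut'\<^esub> g"]) (auto simp: derived_closed)
qed

lemma fused_mono: "fused S x y \<Longrightarrow> T \<subseteq> S \<Longrightarrow> fused T x y"
  unfolding fused_def by blast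

lemma fused_refl: "x \<in> V \<Longrightarrow> S \<subseteq> V \<Longrightarrow> fused S x x"
  by (rule fusedI[of "\<one>\<^bsub>Aut'\<^esub>"]) (auto simp: derived_one)

lemma derived_conjugate:
  assumes "f \<in> carrier Aut" "g \<in> carrier Aut'"
  shows "inv\<^bsub>Aut\<^esub> f \<otimes>\<^bsub>Aut\<^esub> g \<otimes>\<^bsub>Aut\<^esub> f \<in> carrier Aut'"
  using normal.inv_op_closed1[OF Aut.derived_self_is_normal assms(1)] assms(2)
  by (simp add: derived_group_def)

text \<open>The derived group is normal, so it contains the conjugate of \<open>g\<close> by an automorphism \<open>f\<close> even when \<open>f\<close>
  lies outside it. This is how an outer automorphism contributes new elements.\<close>

lemma fused_conjugate:
  assumes f: "f \<in> carrier Aut" and g: "g \<in> carrier Aut'" and S: "S \<subseteq> V" "\<And>s. s \<in> S \<Longrightarrow> g (f s) = f s"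
    and xy: "x \<in> V" "y \<in> V" "g (f x) = f y"
  shows "fused S x y"
proof -
  let ?c = "inv\<^bsub>Aut\<^esub> f \<otimes>\<^bsub>Aut\<^esub> g \<otimes>\<^bsub>Aut\<^esub> f"
  have c: "?c \<in> carrier Aut'" by (rule derived_conjugate[OF f g])
  have "?c v = (inv\<^bsub>Aut\<^esub> f) (g (f v))" if "v \<in> V" for v
    using f derived_mem_Aut[OF g] that by (simp add: Aut_mult Aut_closed)
  with S xy f show ?thesis
    by (intro fusedI[OF c]) (auto simp: Aut_inv)
qed

text \<open>A path whose steps are realised by known elements certifies that its vertices lie in one orbit.\<close>

lemma fused_successively:
  assumes "S \<subseteq> V" "set xs \<subseteq> V" "successively (fused S) xs" "x \<in> set xs" "y \<in> set xs"
  shows "fused S x y"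
proof -
  have hd: "\<forall>x\<in>set xs. fused S (hd xs) x" if "successively (fused S) xs" "set xs \<subseteq> V" for xs
    using that
  proof (induction xs rule: induct_list012)
    case (3 x y zs)
    then show ?case using fused_trans[OF assms(1), of x y] fused_refl[OF _ assms(1)] by auto
  qed (auto intro: fused_refl[OF _ assms(1)])
  show ?thesis
    using hd[OF assms(3,2)] assms(4,5) fused_trans[OF assms(1)] fused_sym[OF assms(1)] by blast
qed

lemma fused_hub:
  assumes "S \<subseteq> V" "\<And>v. v \<in> W \<Longrightarrow> fused S u v" "x \<in> W" "y \<in> W"
  shows "fused S x y"
  using assms(2)[OF assms(3)] assms(2)[OF assms(4)] fused_sym[OF assms(1)] fused_trans[OF assms(1)] by blast

definition stab :: "'v \<Rightarrow> ('v \<Rightarrow> 'v) set" where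
  "stab a = {g \<in> carrier Aut'. g a = a}"

lemma subgroup_stab: "a \<in> V \<Longrightarrow> subgroup (stab a) Aut'"
proof (rule Aut'.subgroupI)
  show "stab a \<noteq> {}" if "a \<in> V"
    using derived_one[OF that] by (auto simp: stab_def)
qed (auto simp: stab_def derived_mult intro: derived_inv[of _ a, simplified] dest: derived_inv[of _ a])

text \<open>The orbits of the stabiliser of \<open>a\<close> are \<open>{a}\<close>, the neighbours and the non-neighbours of \<open>a\<close>. Given
  this, the two existence clauses make the graph and its complement connected: some neighbour of \<open>a\<close> has an edge to a
  non-neighbour, and some non-neighbour has a non-edge to a neighbour.\<close>

definition rank_three_at :: "'v \<Rightarrow> bool" where
  "rank_three_at a \<longleftrightarrow> a \<in> V \<and>
     (\<forall>x\<in>V. \<forall>y\<in>V. x \<noteq> a \<and> y \<noteq> a \<and> (adj a x \<longleftrightarrow> adj a y) \<longrightarrow> fused {a} x y) \<and>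
     (\<exists>b\<in>V. \<exists>x\<in>V. b \<noteq> a \<and> adj a b \<and> x \<noteq> a \<and> \<not> adj a x \<and> x \<noteq> b \<and> adj b x) \<and>
     (\<exists>c\<in>V. \<exists>y\<in>V. c \<noteq> a \<and> \<not> adj a c \<and> y \<noteq> a \<and> adj a y \<and> y \<noteq> c \<and> \<not> adj c y)"

text \<open>All clauses are invariant under the group, so an element moving \<open>a\<close> to \<open>v\<close> transports them.\<close>

lemma rank_three_at_fused:
  assumes "rank_three_at a" "fused {} a v"
  shows "rank_three_at v"
proof -
  from assms obtain g where g: "g \<in> carrier Aut'" "g a = v" "a \<in> V"
    by (auto simp: fused_def)
  let ?g' = "inv\<^bsub>Aut'\<^esub> g"
  have g': "?g' \<in> carrier Aut'" using g by simp
  have r: "\<exists>x'\<in>V. x = g x'" if "x \<in> V" for x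
    using derived_closed[OF g' that] derived_inv[OF g' that] g(1) by (metis Aut'.inv_inv)
  have tr: "fused {v} (g x) (g y)" if "x \<in> V" "y \<in> V" "fused {a} x y" for x y
  proof -
    from that obtain h where h: "h \<in> carrier Aut'" "h a = a" "h x = y" by (auto simp: fused_def)
    show ?thesis
    proof (rule fusedI[of "g \<otimes>\<^bsub>Aut'\<^esub> h \<otimes>\<^bsub>Aut'\<^esub> ?g'"])
      have e: "(g \<otimes>\<^bsub>Aut'\<^esub> h \<otimes>\<^bsub>Aut'\<^esub> ?g') (g z) = g (h z)" if "z \<in> V" for z
        using that g h g' by (simp add: derived_mult derived_closed derived_inv)
      show "(g \<otimes>\<^bsub>Aut'\<^esub> h \<otimes>\<^bsub>Aut'\<^esub> ?g') s = s" if "s \<in> {v}" for s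
        using e[of a] g h that by simp
      show "(g \<otimes>\<^bsub>Aut'\<^esub> h \<otimes>\<^bsub>Aut'\<^esub> ?g') (g x) = g y"
        using e[of x] h that by simp
    qed (use g h g' that in \<open>auto simp: derived_closed\<close>)
  qed
  note gs = derived_adj[OF g(1)] derived_inj[OF g(1)] derived_closed[OF g(1)]
  from assms(1) have 1: "\<And>x y. x \<in> V \<Longrightarrow> y \<in> V \<Longrightarrow> x \<noteq> a \<Longrightarrow> y \<noteq> a \<Longrightarrow> adj a x \<longleftrightarrow> adj a y \<Longrightarrow> fused {a} x y"
    and 2: "\<exists>b\<in>V. \<exists>x\<in>V. b \<noteq> a \<and> adj a b \<and> x \<noteq> a \<and> \<not> adj a x \<and> x \<noteq> b \<and> adj b x"
    and 3: "\<exists>c\<in>V. \<exists>y\<in>V. c \<noteq> a \<and> \<not> adj a c \<and> y \<noteq> a \<and> adj a y \<and> y \<noteq> c \<and> \<not> adj c y"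
    unfolding rank_three_at_def by blast+
  show ?thesis
    unfolding rank_three_at_def
  proof (intro conjI ballI impI)
    show "v \<in> V" using g gs by auto
    fix x y assume xy: "x \<in> V" "y \<in> V" "x \<noteq> v \<and> y \<noteq> v \<and> (adj v x \<longleftrightarrow> adj v y)"
    obtain x' y' where "x' \<in> V" "y' \<in> V" "x = g x'" "y = g y'"
      using r[OF xy(1)] r[OF xy(2)] by blast
    then show "fused {v} x y" using xy tr[of x' y'] 1[of x' y'] g by (auto simp: gs)
  next
    from 2 obtain b x where "b \<in> V" "x \<in> V" "b \<noteq> a" "adj a b" "x \<noteq> a" "\<not> adj a x" "x \<noteq> b" "adj b x"
      by blast
    then show "\<exists>b\<in>V. \<exists>x\<in>V. b \<noteq> v \<and> adj v b \<and> x \<noteq> v \<and> \<not> adj v x \<and> x \<noteq> b \<and> adj b x"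
      using g by (intro bexI[of _ "g b"] bexI[of _ "g x"]) (auto simp: gs)
  next
    from 3 obtain b x where "b \<in> V" "x \<in> V" "b \<noteq> a" "\<not> adj a b" "x \<noteq> a" "adj a x" "x \<noteq> b" "\<not> adj b x"
      by blast
    then show "\<exists>c\<in>V. \<exists>y\<in>V. c \<noteq> v \<and> \<not> adj v c \<and> y \<noteq> v \<and> adj v y \<and> y \<noteq> c \<and> \<not> adj c y"
      using g by (intro bexI[of _ "g b"] bexI[of _ "g x"]) (auto simp: gs)
  qed
qed

text \<open>A group \<open>K\<close> between the stabiliser of \<open>a\<close> and the whole group is determined by the orbit \<open>K a\<close>, which is
  a union of orbits of the stabiliser. If \<open>K\<close> is larger than the stabiliser, then \<open>K a\<close> contains all
  neighbours or all non-neighbours of \<open>a\<close>. Being invariant under \<open>K\<close>, it then contains with each of its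
  points \<open>u\<close> all neighbours, or all non-neighbours, of \<open>u\<close>; by connectedness it is everything.\<close>

lemma maximal_stab:
  assumes r3: "rank_three_at a" and trans: "\<And>v. v \<in> V \<Longrightarrow> fused {} a v"
  shows "maximal_subgroup (stab a) Aut'"
  unfolding maximal_subgroup_def
proof (intro conjI allI impI)
  have a: "a \<in> V" using r3 by (simp add: rank_three_at_def)
  then show "subgroup (stab a) Aut'" by (rule subgroup_stab)
  from r3 obtain b x where b: "b \<in> V" "b \<noteq> a" "adj a b" and x: "x \<in> V" "x \<noteq> a" "\<not> adj a x" "x \<noteq> b" "adj b x"
    unfolding rank_three_at_def by blast
  from r3 obtain c y where c: "c \<in> V" "c \<noteq> a" "\<not> adj a c" and y: "y \<in> V" "y \<noteq> a" "adj a y" "y \<noteq> c" "\<not> adj c y"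
    unfolding rank_three_at_def by blast
  show "stab a \<noteq> carrier Aut'"
    using trans[OF b(1)] b(2) by (auto simp: fused_def stab_def)
  fix K assume K: "subgroup K Aut' \<and> stab a \<subseteq> K"
  interpret K: subgroup K Aut' using K by blast
  have KA: "g \<in> carrier Aut'" if "g \<in> K" for g using that by simp
  define Ka where "Ka = (\<lambda>k. k a) ` K"
  have Ka_stab: "v \<in> Ka" if "u \<in> Ka" "fused {a} u v" for u v
  proof -
    from that obtain k g where k: "k \<in> K" "u = k a" and g: "g \<in> carrier Aut'" "g a = a" "g u = v"
      by (auto simp: Ka_def fused_def)
    then have "g \<in> K" using K by (auto simp: stab_def)
    then have "g \<otimes>\<^bsub>Aut'\<^esub> k \<in> K" using k by simp
    moreover have "(g \<otimes>\<^bsub>Aut'\<^esub> k) a = v" using g k a KA by (simp add: derived_mult)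
    ultimately show ?thesis unfolding Ka_def by (metis imageI)
  qed
  have Ka_closed: "k u \<in> Ka" if "k \<in> K" "u \<in> Ka" for k u
  proof -
    from that obtain l where l: "l \<in> K" "u = l a" by (auto simp: Ka_def)
    then have "(k \<otimes>\<^bsub>Aut'\<^esub> l) a = k u" using that a KA by (simp add: derived_mult)
    moreover have "k \<otimes>\<^bsub>Aut'\<^esub> l \<in> K" using that l by simp
    ultimately show ?thesis unfolding Ka_def by (metis imageI)
  qed
  have same: "v \<in> Ka" if "u \<in> Ka" "u \<noteq> a" "u \<in> V" "v \<in> V" "v \<noteq> a" "adj a u \<longleftrightarrow> adj a v" for u v
    using r3 that Ka_stab[of u v] unfolding rank_three_at_def by blast
  \<comment> \<open>An element of \<open>K\<close> taking \<open>a\<close> to \<open>u\<close> carries the adjacency of \<open>a\<close> over to \<open>u\<close>.\<close>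
  have step: "v \<in> Ka" if u: "u \<in> Ka" "u \<noteq> a" "u \<in> V" and v: "v \<in> V" "v \<noteq> u" "v \<noteq> a" and uv: "adj u v \<longleftrightarrow> adj a u" for u v
  proof -
    from u obtain k where k: "k \<in> K" "u = k a" by (auto simp: Ka_def)
    let ?w = "(inv\<^bsub>Aut'\<^esub> k) v"
    have k': "inv\<^bsub>Aut'\<^esub> k \<in> K" using k by simp
    have w: "?w \<in> V" using derived_closed[OF KA[OF k'] v(1)] .
    have kw: "k ?w = v"
      using derived_inv[OF KA[OF k'] v(1)] KA[OF k(1)] by simp
    have "?w \<noteq> a" using kw v k by auto
    moreover have "adj a ?w \<longleftrightarrow> adj u v" using derived_adj[OF KA[OF k(1)] a w] kw k by simp
    ultimately have "?w \<in> Ka" using same[of u ?w] u w uv by simp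
    from Ka_closed[OF k(1) this] kw show ?thesis by simp
  qed
  show "K = stab a \<or> K = carrier Aut'"
  proof (cases "K \<subseteq> stab a")
    case False
    then obtain k where k: "k \<in> K" "k a \<noteq> a" by (auto simp: stab_def)
    let ?u = "k a"
    have u: "?u \<in> Ka" "?u \<in> V" using k a KA derived_closed by (auto simp: Ka_def)
    have "b \<in> Ka \<and> c \<in> Ka"
    proof (cases "adj a ?u")
      case True
      then have bO: "b \<in> Ka" using same[of ?u b] u k b by simp
      then have "x \<in> Ka" using step[of b x] b x by simp
      then have "c \<in> Ka" using same[of x c] x c by simp
      with bO show ?thesis by simp
    next
      case False
      then have cO: "c \<in> Ka" using same[of ?u c] u k c by simp
      then have "y \<in> Ka" using step[of c y] c y by simp
      then have "b \<in> Ka" using same[of y b] y b by simp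
      with cO show ?thesis by simp
    qed
    moreover have "a \<in> Ka" using K.one_closed derived_one[OF a] unfolding Ka_def by (metis imageI)
    ultimately have Ka: "V \<subseteq> Ka" using same[of b] same[of c] b c by (metis subsetI)
    have "g \<in> K" if g: "g \<in> carrier Aut'" for g
    proof -
      from Ka derived_closed[OF g a] obtain k where k: "k \<in> K" "g a = k a" by (auto simp: Ka_def)
      let ?s = "inv\<^bsub>Aut'\<^esub> k \<otimes>\<^bsub>Aut'\<^esub> g"
      have k': "inv\<^bsub>Aut'\<^esub> k \<in> K" using k by simp
      have "?s a = a" using g k a KA[OF k'] KA[OF k(1)] by (simp add: derived_mult derived_inv)
      then have "?s \<in> K" using K g KA[OF k'] by (auto simp: stab_def)
      then have "k \<otimes>\<^bsub>Aut'\<^esub> ?s \<in> K" using k by simp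
      moreover have "k \<otimes>\<^bsub>Aut'\<^esub> ?s = g"
        using KA[OF k(1)] g by (simp flip: Aut'.m_assoc)
      ultimately show ?thesis by simp
    qed
    then show ?thesis using K.subset by blast
  qed (use K in auto)
qed

text \<open>A witness for the position of \<open>x\<close> in the family of stabilisers of the points of \<open>S\<close>: an element that
  lies in all of them except the stabiliser of \<open>x\<close>.\<close>

definition moved_alone :: "'v set \<Rightarrow> 'v \<Rightarrow> bool" where
  "moved_alone S x \<longleftrightarrow> (\<exists>g\<in>carrier Aut'. g x \<noteq> x \<and> (\<forall>y\<in>S - {x}. g y = y))"

text \<open>A symmetry \<open>f\<close> of \<open>S\<close> turns a witness for \<open>f x\<close> into one for \<open>x\<close>, so one witness per orbit of
  symmetries is enough.\<close>

lemma moved_alone_conjugate: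
  assumes f: "f \<in> carrier Aut" and S: "S \<subseteq> V" "f ` S \<subseteq> S" and x: "x \<in> S" "moved_alone S (f x)"
  shows "moved_alone S x"
proof -
  from x obtain g where g: "g \<in> carrier Aut'" "g (f x) \<noteq> f x" "\<forall>y\<in>S - {f x}. g y = y"
    unfolding moved_alone_def by blast
  let ?c = "inv\<^bsub>Aut\<^esub> f \<otimes>\<^bsub>Aut\<^esub> g \<otimes>\<^bsub>Aut\<^esub> f"
  have c: "?c \<in> carrier Aut'" by (rule derived_conjugate[OF f g(1)])
  have inj: "f u = f v \<longleftrightarrow> u = v" if "u \<in> V" "v \<in> V" for u v
    using Aut_inv[OF f] that by metis
  have e: "f (?c v) = g (f v)" if "v \<in> V" for v
  proof -
    have "f \<otimes>\<^bsub>Aut\<^esub> ?c = g \<otimes>\<^bsub>Aut\<^esub> f"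
      using f derived_mem_Aut[OF g(1)] by (simp flip: Aut.m_assoc)
    then have "(f \<otimes>\<^bsub>Aut\<^esub> ?c) v = (g \<otimes>\<^bsub>Aut\<^esub> f) v" by simp
    then show ?thesis
      using that f derived_mem_Aut[OF g(1)] derived_mem_Aut[OF c] by (simp add: Aut_mult)
  qed
  have cl: "?c v \<in> V" if "v \<in> V" for v using derived_closed[OF c that] .
  show ?thesis
    unfolding moved_alone_def
  proof (intro bexI[OF _ c] conjI ballI)
    have "x \<in> V" using x S by blast
    then show "?c x \<noteq> x" using e g(2) by metis
    fix y assume y: "y \<in> S - {x}"
    then have "y \<in> V" "f y \<in> S - {f x}" using S inj[of y x] \<open>x \<in> V\<close> by auto
    then have "f (?c y) = f y" using e g(3) by simp
    then show "?c y = y" using inj cl \<open>y \<in> V\<close> by blast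
  qed
qed

lemma general_position_stab:
  assumes xs: "distinct xs" "set xs \<subseteq> V" and alone: "\<And>x. x \<in> set xs \<Longrightarrow> moved_alone (set xs) x"
  shows "general_position Aut' (map stab xs)"
  unfolding general_position_def
proof (intro allI impI)
  fix i assume i: "i < length (map stab xs)"
  then obtain g where g: "g \<in> carrier Aut'" "g (xs ! i) \<noteq> xs ! i" "\<forall>y\<in>set xs - {xs ! i}. g y = y"
    using alone[of "xs ! i"] unfolding moved_alone_def by auto
  have "g \<in> stab (xs ! j)" if "j < length xs" "j \<noteq> i" for j
    using g that i xs(1) by (auto simp: stab_def nth_eq_iff_index_eq)
  then have "g \<in> carrier Aut' \<inter> (\<Inter>j\<in>{..<length (map stab xs)} - {i}. map stab xs ! j)"
    using g(1) by auto
  moreover have "g \<notin> carrier Aut' \<inter> (\<Inter>j\<in>{..<length (map stab xs)}. map stab xs ! j)"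
    using g(2) i by (auto simp: stab_def)
  ultimately show "carrier Aut' \<inter> (\<Inter>j\<in>{..<length (map stab xs)}. map stab xs ! j)
      \<subset> carrier Aut' \<inter> (\<Inter>j\<in>{..<length (map stab xs)} - {i}. map stab xs ! j)"
    by blast
qed

lemma MaxDim_ge_stabilisers:
  assumes r3: "rank_three_at a" and trans: "\<And>v. v \<in> V \<Longrightarrow> fused {} a v"
    and xs: "distinct xs" "set xs \<subseteq> V" "\<And>x. x \<in> set xs \<Longrightarrow> moved_alone (set xs) x"
  shows "length xs \<le> MaxDim Aut'"
proof -
  have "maximal_subgroup (stab v) Aut'" if "v \<in> V" for v
  proof (rule maximal_stab)
    show "rank_three_at v" using rank_three_at_fused[OF r3 trans[OF that]] .
    show "fused {} v u" if "u \<in> V" for u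
      using trans[OF \<open>v \<in> V\<close>] trans[OF that] by (metis empty_subsetI fused_sym fused_trans)
  qed
  with MaxDim_ge[OF finite_derived _ general_position_stab[OF xs]] xs(2) show ?thesis by auto
qed

end

section \<open>Sets of natural numbers as binary words\<close>

text \<open>A natural number stands for the set of positions of its binary digits 1. The rules on binary numerals
  below let the simplifier compute with sets written in this way.\<close>

definition bits :: "nat \<Rightarrow> nat set" where
  "bits w = {i. bit w i}"

lemma mem_bits [simp]: "m \<in> bits n \<longleftrightarrow> bit n m"
  by (simp add: bits_def)

lemma bits_eq_iff: "bits v = bits w \<longleftrightarrow> v = w"
  by (auto simp: bits_def Set.set_eq_iff bit_eq_iff)

lemma bits_0 [simp]: "bits 0 = {}"
  by (simp add: bits_def)

lemma bits_double: "bits (2 * w) = Suc ` bits w"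
proof (rule Set.set_eqI)
  fix i show "i \<in> bits (2 * w) \<longleftrightarrow> i \<in> Suc ` bits w"
    by (cases i) (auto simp: bits_def bit_0 bit_Suc)
qed

lemma bits_double_Suc: "bits (Suc (2 * w)) = insert 0 (Suc ` bits w)"
proof (rule Set.set_eqI)
  fix i show "i \<in> bits (Suc (2 * w)) \<longleftrightarrow> i \<in> insert 0 (Suc ` bits w)"
    by (cases i) (auto simp: bits_def bit_0 bit_Suc)
qed

lemma bits_numeral:
  "bits 1 = {0}"
  "bits (numeral (num.Bit0 n)) = Suc ` bits (numeral n)"
  "bits (numeral (num.Bit1 n)) = insert 0 (Suc ` bits (numeral n))"
  using bits_double_Suc[of 0] bits_double[of "numeral n"] bits_double_Suc[of "numeral n"]
  by (simp_all add: numeral_Bit0 numeral_Bit1 mult_2)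

lemma finite_bits [simp]: "finite (bits w)"
proof (rule finite_subset)
  show "bits w \<subseteq> {..<w}"
    by (auto simp: bits_def bit_iff_odd) (metis div_less even_zero less_exp not_less order.strict_trans2)
qed simp

lemma bits_xor: "bits (xor v w) = sym_diff (bits v) (bits w)"
  by (auto simp: bits_def bit_xor_iff)

lemma bits_insert: "insert a (bits w) = bits (or (2 ^ a) w)"
  by (auto simp: bits_def bit_or_iff bit_exp_iff)

text \<open>Both adjacency relations between blocks are conditions on the size of an intersection.\<close>

definition meet :: "nat \<Rightarrow> nat \<Rightarrow> nat" where
  "meet v w = card (bits v \<inter> bits w)"

lemma Suc_image_Int: "Suc ` A \<inter> Suc ` B = Suc ` (A \<inter> B)"
  by auto

lemma meet_simps [simp]:
  "meet 0 w = 0"  "meet w 0 = 0"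
  "meet 1 1 = 1"
  "meet 1 (numeral (num.Bit0 n)) = 0"
  "meet 1 (numeral (num.Bit1 n)) = 1"
  "meet (numeral (num.Bit0 m)) 1 = 0"
  "meet (numeral (num.Bit1 m)) 1 = 1"
  "meet (numeral (num.Bit0 m)) (numeral (num.Bit0 n)) = meet (numeral m) (numeral n)"
  "meet (numeral (num.Bit0 m)) (numeral (num.Bit1 n)) = meet (numeral m) (numeral n)"
  "meet (numeral (num.Bit1 m)) (numeral (num.Bit0 n)) = meet (numeral m) (numeral n)"
  "meet (numeral (num.Bit1 m)) (numeral (num.Bit1 n)) = Suc (meet (numeral m) (numeral n))"
  by (simp_all only: meet_def bits_numeral)
     (simp_all add: Suc_image_Int card_image image_iff Int_insert_left)

lemmas meet_simps_Suc [simp] = meet_simps[unfolded One_nat_def]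

text \<open>The word of the image of a set under the permutation with the given list of values.\<close>

fun relabel :: "nat list \<Rightarrow> nat \<Rightarrow> nat" where
  "relabel [] w = 0"
| "relabel (a # as) w = (if odd w then or (2 ^ a) (relabel as (w div 2)) else relabel as (w div 2))"

lemma bits_relabel: "bits (relabel as w) = (!) as ` (bits w \<inter> {..<length as})"
proof (induction as w rule: relabel.induct)
  case (1 w) then show ?case by simp
next
  case (2 a as w)
  have split: "bits w = (if odd w then insert 0 else id) (Suc ` bits (w div 2))"
    using bits_double[of "w div 2"] bits_double_Suc[of "w div 2"] by (cases "odd w") auto
  have "bits w \<inter> {..<length (a # as)} =
      (if odd w then insert 0 else id) (Suc ` (bits (w div 2) \<inter> {..<length as}))"
    unfolding split by (auto simp: image_iff)
  moreover have "(!) (a # as) ` Suc ` S = (!) as ` S" for S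
    by (simp add: image_image)
  ultimately show ?case
    using 2 by (auto simp: bits_insert[symmetric])
qed

text \<open>Only words that are binary numerals may be unfolded: on a variable word the conditional in the
  recursion would double the term at every step.\<close>

declare relabel.simps [simp del]

lemma relabel_simps [simp]:
  "relabel [] w = 0"
  "relabel as 0 = 0"
  "relabel (a # as) 1 = 2 ^ a"
  "relabel (a # as) (numeral (num.Bit0 n)) = relabel as (numeral n)"
  "relabel (a # as) (numeral (num.Bit1 n)) = or (2 ^ a) (relabel as (numeral n))"
proof -
  show 0: "relabel as 0 = 0" for as by (induction as) (simp_all add: relabel.simps)
  show "relabel [] w = 0"
    "relabel (a # as) 1 = 2 ^ a"
    "relabel (a # as) (numeral (num.Bit0 n)) = relabel as (numeral n)"
    "relabel (a # as) (numeral (num.Bit1 n)) = or (2 ^ a) (relabel as (numeral n))"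
    by (simp_all add: relabel.simps 0)
qed

lemmas relabel_Suc_0 [simp] = relabel_simps(3)[unfolded One_nat_def]

lemma bits_subset_if_less: "w < 2 ^ n \<Longrightarrow> bits w \<subseteq> {..<n}"
proof
  fix i assume w: "w < 2 ^ n" and "i \<in> bits w"
  then have "odd (w div 2 ^ i)" by (simp add: bits_def bit_iff_odd)
  then have "w div 2 ^ i \<noteq> 0" by (metis even_zero)
  then have "2 ^ i \<le> w" by (metis div_less not_le)
  with w have "(2::nat) ^ i < 2 ^ n" by linarith
  then show "i \<in> {..<n}" by simp
qed

definition word_of :: "nat list \<Rightarrow> nat" where
  "word_of as = foldr (\<lambda>a. or (2 ^ a)) as 0"

lemma bits_word_of: "bits (word_of as) = set as"
  by (induction as) (simp_all add: word_of_def bits_insert[symmetric])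

text \<open>The linear span over the field with two elements.\<close>

fun span :: "nat list \<Rightarrow> nat set" where
  "span [] = {0}"
| "span (b # bs) = span bs \<union> (\<lambda>v. xor v b) ` span bs"

lemma zero_in_span: "0 \<in> span bs"
  by (induction bs) auto

lemma xor_in_span: "v \<in> span bs \<Longrightarrow> w \<in> span bs \<Longrightarrow> xor v w \<in> span bs"
proof (induction bs arbitrary: v w)
  case (Cons b bs)
  from Cons.prems obtain v' w' where vw: "v' \<in> span bs" "w' \<in> span bs"
    "v \<in> {v', xor v' b}" "w \<in> {w', xor w' b}" by auto
  then have "xor v w \<in> {xor v' w', xor (xor v' w') b}"
    by (elim insertE emptyE) (auto simp: bit_eq_iff bit_xor_iff)
  with Cons.IH[OF vw(1,2)] show ?case by auto
qed simp

text \<open>Gaussian elimination over the field with two elements. If the words \<open>b\<close> have decreasing leading bits,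
  then \<open>xor w b < w\<close> says exactly that \<open>w\<close> has the leading bit of \<open>b\<close>, so the minimum clears that bit.\<close>

fun reduce :: "nat list \<Rightarrow> nat \<Rightarrow> nat" where
  "reduce [] w = w"
| "reduce (b # bs) w = reduce bs (min w (xor w b))"

lemma reduce_xor_in_span: "xor (reduce bs w) w \<in> span bs"
proof (induction bs arbitrary: w)
  case (Cons b bs)
  have "xor (reduce (b # bs) w) w \<in>
      {xor (reduce bs w) w, xor (xor (reduce bs (xor w b)) (xor w b)) b}"
    by (auto simp: min_def bit_eq_iff bit_xor_iff)
  with Cons.IH show ?case by auto
qed simp

lemma in_spanI: "reduce bs w = 0 \<Longrightarrow> w \<in> span bs"
  using reduce_xor_in_span[of bs w] by simp

text \<open>Runs through all sums of basis words; the second word accumulates the sum.\<close>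

fun all_words :: "(nat \<Rightarrow> bool) \<Rightarrow> nat list \<Rightarrow> nat \<Rightarrow> bool" where
  "all_words P [] w = P w"
| "all_words P (b # bs) w \<longleftrightarrow> all_words P bs w \<and> all_words P bs (xor w b)"

lemma all_words_span: "all_words P bs w \<Longrightarrow> v \<in> span bs \<Longrightarrow> P (xor v w)"
proof (induction bs arbitrary: v w)
  case (Cons b bs)
  have s: "xor (xor x b) w = xor x (xor w b)" for x
    by (simp add: ac_simps)
  show ?case using Cons by (auto simp: s)
qed simp

section \<open>The Golay code and its words of weight seven\<close>

text \<open>The generating set of the code, and the same sets as words.\<close>

abbreviation golay_row :: "nat \<Rightarrow> nat set" where
  "golay_row i \<equiv> (\<lambda>k. (k ^ 2 + i) mod 23) ` {1..22}"

definition golay_rows :: "nat list" where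
  "golay_rows = map (\<lambda>i. word_of (map (\<lambda>k. (k ^ 2 + i) mod 23) [1..<23])) [0..<23]"

text \<open>The twelve shifts of the generator polynomial with the exponents 0, 1, 5, 6, 7, 9 and 11, the
  one with the highest degree first so that \<open>reduce\<close> applies.\<close>

definition golay_basis :: "nat list" where
  "golay_basis = [5707776, 2853888, 1426944, 713472, 356736, 178368,
     89184, 44592, 22296, 11148, 5574, 2787]"

text \<open>The intervals are spelt out once so that maps over them evaluate entry by entry.\<close>

lemma upt_23: "[0..<23] = [0, 1, 2, 3, 4, 5, 6, 7, 8, 9, 10, 11, 12, 13, 14, 15, 16, 17, 18, 19, 20, 21, 22::nat]"
  by (simp add: upt_rec)

lemma upt_1_23: "[1..<23] = [1, 2, 3, 4, 5, 6, 7, 8, 9, 10, 11, 12, 13, 14, 15, 16, 17, 18, 19, 20, 21, 22::nat]"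
  by (simp add: upt_rec)

lemma upt_12: "[0..<12] = [0, 1, 2, 3, 4, 5, 6, 7, 8, 9, 10, 11::nat]"
  by (simp add: upt_rec)

lemma golay_rows_eq: "golay_rows = [
    340830, 681660, 1363320, 2726640, 5453280, 2517953, 5035906, 1683205, 3366410, 6732820,
    5077033, 1765459, 3530918, 7061836, 5735065, 3081523, 6163046, 3937485, 7874970,
    7361333, 6334059, 4279511, 170415]"
  unfolding golay_rows_def upt_23 upt_1_23 by (simp add: word_of_def)

lemma golay_row_eq: "golay_row i = bits (golay_rows ! (i mod 23))"
proof -
  have "{1..22} = set [1..<23::nat]" by auto
  then have "golay_row i = (\<lambda>k. (k ^ 2 + i mod 23) mod 23) ` set [1..<23]"
    by (simp only: mod_add_right_eq)
  also have "\<dots> = bits (golay_rows ! (i mod 23))"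
    by (simp add: golay_rows_def bits_word_of)
  finally show ?thesis .
qed

text \<open>Hiding the call of \<open>reduce\<close> behind a constant keeps the simplifier from expanding it on a variable
  word, where the repeated minimum would grow exponentially.\<close>

definition in_golay :: "nat \<Rightarrow> bool" where
  "in_golay w \<longleftrightarrow> reduce golay_basis w = 0"

lemma in_golay_numeral [simp]: "in_golay (numeral n) \<longleftrightarrow> reduce golay_basis (numeral n) = 0"
  by (simp add: in_golay_def)

lemma in_golayD: "in_golay w \<Longrightarrow> w \<in> span golay_basis"
  by (simp add: in_golay_def in_spanI)

lemma golay_rows_in_span: "w \<in> set golay_rows \<Longrightarrow> w \<in> span golay_basis"
proof -
  have "list_all in_golay golay_rows"
    by (simp add: golay_rows_eq golay_basis_def)
  then show "w \<in> set golay_rows \<Longrightarrow> w \<in> span golay_basis"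
    by (auto simp: list_all_iff intro: in_golayD)
qed

text \<open>The generator polynomial is the sum of the translates with numbers 10, 11 and 14, and its shifts are
  the sums of the shifted translates.\<close>

lemma golay_basis_from_rows:
  "map (\<lambda>j::nat. foldr xor (map (\<lambda>i. golay_rows ! ((i + j) mod 23)) [10, 11, 14]) 0) [0..<12] = rev golay_basis"
  unfolding upt_12 list.map by (simp add: golay_rows_eq golay_basis_def)

lemma golay_code_sym_diff:
  assumes "U \<in> golay_code" "W \<in> golay_code"
  shows "sym_diff U W \<in> golay_code"
  using assms(2)
proof (induction W)
  case (add W i)
  have "sym_diff U (sym_diff W (golay_row i)) = sym_diff (sym_diff U W) (golay_row i)"
    by auto
  with golay_code.add[OF add.IH, of i] show ?case by simp
qed (use assms(1) in simp)

lemma golay_code_eq_span: "golay_code = bits ` span golay_basis"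
proof (intro equalityI subsetI)
  fix W assume "W \<in> golay_code"
  then show "W \<in> bits ` span golay_basis"
  proof induction
    case zero
    show ?case using zero_in_span[of golay_basis] bits_0 by (metis imageI)
  next
    case (add W i)
    then obtain w where "w \<in> span golay_basis" "W = bits w" by blast
    moreover have "golay_rows ! (i mod 23) \<in> span golay_basis"
      by (rule golay_rows_in_span) (simp add: golay_rows_def)
    ultimately show ?case
      unfolding golay_row_eq by (metis bits_xor imageI xor_in_span)
  qed
next
  have row: "bits (golay_rows ! (i mod 23)) \<in> golay_code" for i
    using golay_code.add[OF golay_code.zero, of i]
    by (simp add: golay_row_eq del: One_nat_def)
  have basis: "bits b \<in> golay_code" if "b \<in> set golay_basis" for b
  proof -
    from that have "b \<in> set (rev golay_basis)" by simp
    then have "b \<in> (\<lambda>j. foldr xor (map (\<lambda>i. golay_rows ! ((i + j) mod 23)) [10, 11, 14]) 0) ` {..<12}"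
      unfolding golay_basis_from_rows[symmetric] set_map by (simp only: set_upt lessThan_atLeast0)
    then obtain j where
      "b = foldr xor (map (\<lambda>i. golay_rows ! ((i + j) mod 23)) [10, 11, 14]) 0"
      by (elim imageE)
    then show ?thesis
      by (simp only: list.map foldr.simps comp_apply id_apply bits_xor bits_0 golay_code_sym_diff row golay_code.zero)
  qed
  have span: "bits w \<in> golay_code" if "w \<in> span bs" "\<forall>b\<in>set bs. bits b \<in> golay_code" for bs w
    using that
    by (induction bs arbitrary: w)
       (auto simp: bits_xor golay_code.zero simp del: Un_Diff_cancel intro!: golay_code_sym_diff)
  show "W \<in> golay_code" if "W \<in> bits ` span golay_basis" for W
    using that span basis by blast
qed

text \<open>Removing the points 0 and 1 from the Witt design leaves the projective plane of order 4 on the points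
  2 to 22. Blocks through both 0 and 1 are its 21 lines. Blocks through exactly one of them are
  hyperovals, 56 through 0 and 56 through 1, and the 120 blocks through neither are its Baer subplanes.
  Together with the points 2 to 22 these are the orbits of \<open>L\<^sub>3(4)\<close>, the stabiliser of 0 and 1. Each list is
  ordered as a path: each entry is taken to the next by one of two generators of \<open>L\<^sub>3(4)\<close> or its inverse, so
  that the list is a certificate for transitivity.\<close>

definition points :: "nat list" where
  "points = [
     16, 22, 21, 15, 7, 17, 14, 18, 5, 13, 10, 4, 8, 2, 3, 11, 12, 19, 6, 20, 9]"

definition lines :: "nat list" where
  "lines = [
     786519, 1066059, 5245191, 2101775, 567307, 2787, 1769987, 1347715, 155783, 2261315,
     4243987, 2443267, 4587563, 99367, 65947, 138259, 545059, 272131, 3153971, 4272195,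
     6816899]"

definition hyperovals :: "nat list" where
  "hyperovals = [
     688305, 562753, 1581505, 1183845, 52609, 139865, 1838113, 13481, 45333, 2624273,
     4263433, 1384461, 18493, 656653, 1050261, 1082153, 2108485, 5771289, 596101, 268617,
     1079809, 3278985, 4227277, 82757, 1458449, 459969, 319585, 5324961, 6488085, 6316297,
     6330401, 3026945, 4330369, 3719173, 7602753, 2204289, 5415937, 2359717, 4195697,
     615441, 332337, 207137, 4477957, 2687081, 1149009, 803465, 428549, 249865, 4868161,
     2117841, 5079297, 2246177, 4466833, 3216641, 4727333, 2393113]"

definition hyperovals' :: "nat list" where
  "hyperovals' = [
     4786226, 90666, 3539974, 5374162, 639170, 2916898, 6433282, 2159618, 6557970, 2695430,
     4203550, 2100522, 276518, 857098, 26962, 5248546, 1125506, 131894, 311566, 4216970,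
     198734, 1573038, 5574, 1606930, 2164306, 4235682, 2298018, 499730, 4408578, 279730,
     664674, 537234, 105218, 1313306, 544262, 36986, 919938, 165514, 1230882, 414274,
     6053890, 6307942, 2367690, 4886534, 2768922, 4492354, 3163010, 1090118, 3676226,
     4719434, 1134614, 1376610, 4522630, 7438346, 2132118, 1192202]"

definition subplanes :: "nat list" where
  "subplanes = [
     2753220, 1998920, 215696, 5296448, 2901312, 5113360, 2212144, 6628384, 4354096,
     2853888, 4502024, 2648224, 4424288, 6733952, 3366976, 5537844, 591776, 1324112, 725328,
     841744, 4220608, 3179744, 6856784, 6902272, 5707776, 362664, 263788, 1657096, 4201044,
     3679752, 44592, 2177048, 4734208, 2626612, 107848, 2384404, 7995680, 4297872, 2237840,
     1074468, 4264236, 7079948, 2148936, 5802624, 3314192, 713472, 4985056, 89184, 5317392,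
     3997840, 181332, 147944, 1329348, 5390860, 1278340, 295888, 1725568, 1589872, 862784,
     662056, 1088524, 11148, 3146076, 5833796, 6292152, 4319236, 2556680, 4328612, 3428392,
     4596036, 2180236, 4360472, 2367104, 1683488, 73972, 5506440, 2251012, 553036, 5253224,
     3213860, 623132, 1839876, 1183552, 527576, 1055152, 210436, 794936, 331028, 22296,
     1714196, 1118920, 559460, 397468, 420872, 4475680, 1246264, 828548, 2110304, 7359504,
     4538456, 999460, 431392, 356736, 2492528, 4768808, 6359488, 7352452, 2269228, 6326020,
     2658696, 178368, 1450656, 1426944, 4735380, 6427720, 3451136, 53924, 4923528, 2461764,
     1106072]"

definition blocks :: "nat list" where
  "blocks = lines @ hyperovals @ hyperovals' @ subplanes"

text \<open>Here \<open>if\<close> rather than an implication: the simplifier leaves the branch alone until the condition is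
  decided, so the long membership test is made only for the 253 words of weight 7.\<close>

definition block_or_not_seven :: "nat \<Rightarrow> bool" where
  "block_or_not_seven w \<longleftrightarrow> (if meet w w = 7 then w \<in> set blocks else True)"

lemma block_or_not_seven_numeral [simp]:
  "block_or_not_seven 0"
  "block_or_not_seven (numeral n) \<longleftrightarrow>
     (if meet (numeral n) (numeral n) = 7 then numeral n \<in> set blocks else True)"
  by (simp_all add: block_or_not_seven_def)

text \<open>A run through all 4096 words of the code.\<close>

lemma weight_seven_is_block:
  assumes "w \<in> span golay_basis" "meet w w = 7"
  shows "w \<in> set blocks"
proof -
  have "all_words block_or_not_seven golay_basis 0"
    by (simp add: golay_basis_def blocks_def lines_def hyperovals_def hyperovals'_def subplanes_def)
  from all_words_span[OF this assms(1)] show ?thesis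
    using assms(2) by (simp add: block_or_not_seven_def)
qed

lemma blocks_in_span: "list_all (\<lambda>w. in_golay w \<and> meet w w = 7) blocks"
  by (simp add: golay_basis_def blocks_def lines_def hyperovals_def hyperovals'_def subplanes_def)

lemma S4723_eq: "S4723 = bits ` set blocks"
proof -
  have "set blocks = {w \<in> span golay_basis. meet w w = 7}"
    using blocks_in_span weight_seven_is_block by (auto simp: list_all_iff intro: in_golayD)
  then show ?thesis by (auto simp: S4723_def golay_code_eq_span meet_def)
qed

section \<open>The Mathieu group on 22 points acting on graphs\<close>

text \<open>The permutations of the 23 points that preserve the code form \<open>M\<^bsub>23\<^esub>\<close>; those fixing 0 form \<open>M\<^bsub>22\<^esub>\<close>.
  Both graphs are built from the code and the point 0 only, so \<open>M\<^bsub>22\<^esub>\<close> acts on both of them.\<close>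

definition M22 :: "(nat \<Rightarrow> nat) set" where
  "M22 = {\<sigma>. \<sigma> permutes {..<23} \<and> \<sigma> 0 = 0 \<and> (\<forall>W\<in>golay_code. \<sigma> ` W \<in> golay_code)}"

definition perm_of :: "nat list \<Rightarrow> nat \<Rightarrow> nat" where
  "perm_of as i = (if i < length as then as ! i else i)"

lemma perm_of_permutes:
  assumes "distinct as" "set as = {..<length as}"
  shows "perm_of as permutes {..<length as}"
proof (rule bij_imp_permutes)
  have "bij_betw ((!) as) {..<length as} {..<length as}"
    using bij_betw_nth[OF assms(1) refl assms(2)[symmetric]] .
  then show "bij_betw (perm_of as) {..<length as} {..<length as}"
    by (rule bij_betw_cong[THEN iffD1, rotated]) (simp add: perm_of_def)
qed (simp add: perm_of_def)

lemma perm_of_bits: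
  assumes "w < 2 ^ length as"
  shows "perm_of as ` bits w = bits (relabel as w)"
proof -
  have "perm_of as ` bits w = (!) as ` (bits w \<inter> {..<length as})"
    using bits_subset_if_less[OF assms]
    by (intro image_cong) (auto simp: perm_of_def)
  then show ?thesis by (simp add: bits_relabel)
qed

lemma golay_image_if_basis:
  assumes "inj \<sigma>" "\<forall>b\<in>set bs. \<sigma> ` bits b \<in> golay_code" "w \<in> span bs"
  shows "\<sigma> ` bits w \<in> golay_code"
  using assms(2,3)
proof (induction bs arbitrary: w)
  case (Cons b bs)
  have "\<sigma> ` sym_diff U W = sym_diff (\<sigma> ` U) (\<sigma> ` W)" for U W
    using assms(1) by (simp add: image_Un image_set_diff)
  with Cons show ?case
    by (auto simp: bits_xor simp del: Un_Diff_cancel intro!: golay_code_sym_diff)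
qed (simp add: golay_code.zero)

text \<open>An executable criterion: by linearity it is enough to look at the images of the basis words.\<close>

definition golay_perm :: "nat list \<Rightarrow> bool" where
  "golay_perm as \<longleftrightarrow> length as = 23 \<and> as ! 0 = 0 \<and> distinct as \<and> list_all (\<lambda>a. a < 23) as \<and>
     list_all (\<lambda>b. in_golay (relabel as b)) golay_basis"

lemma golay_perm_in_M22:
  assumes "golay_perm as"
  shows "perm_of as \<in> M22"
proof -
  have len: "length as = 23" and as: "distinct as" "set as \<subseteq> {..<23}"
    and b: "\<forall>b\<in>set golay_basis. in_golay (relabel as b)"
    using assms by (auto simp: golay_perm_def list_all_iff)
  have "set as = {..<23}"
    using as len distinct_card[of as] by (intro card_subset_eq) auto
  then have p: "perm_of as permutes {..<23}"
    using perm_of_permutes[of as] as len by simp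
  have "perm_of as ` bits b \<in> golay_code" if "b \<in> set golay_basis" for b
  proof -
    have "list_all (\<lambda>b. b < 2 ^ 23) golay_basis" by (simp add: golay_basis_def)
    then have "b < 2 ^ length as" using that len by (auto simp: list_all_iff)
    then show ?thesis
      using b that by (auto simp: perm_of_bits golay_code_eq_span intro: in_golayD)
  qed
  then have "perm_of as ` W \<in> golay_code" if "W \<in> golay_code" for W
    using golay_image_if_basis[of "perm_of as" golay_basis] that permutes_inj[OF p]
    by (auto simp: golay_code_eq_span[THEN equalityD1, THEN subsetD])
       (metis golay_code_eq_span imageE)
  with p assms show ?thesis
    by (simp add: M22_def golay_perm_def perm_of_def)
qed

fun act :: "(nat \<Rightarrow> nat) \<Rightarrow> vertex \<Rightarrow> vertex" where
  "act \<sigma> Infinity = Infinity"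
| "act \<sigma> (Point p) = Point (\<sigma> p)"
| "act \<sigma> (Block B) = Block (\<sigma> ` B)"

lemma act_comp: "act (\<sigma> \<circ> \<tau>) v = act \<sigma> (act \<tau> v)"
  by (cases v) (auto simp: image_comp)

lemma inj_act: "inj \<sigma> \<Longrightarrow> act \<sigma> u = act \<sigma> v \<longleftrightarrow> u = v"
  by (cases u; cases v) (auto simp: inj_eq inj_image_eq_iff)

lemma M22_inj: "\<sigma> \<in> M22 \<Longrightarrow> inj \<sigma>"
  by (auto simp: M22_def dest: permutes_inj)

lemma M22_zero: "\<sigma> \<in> M22 \<Longrightarrow> \<sigma> i = 0 \<longleftrightarrow> i = 0"
  using inj_eq[OF M22_inj, of \<sigma> i 0] by (auto simp: M22_def)

lemma M22_point: "\<sigma> \<in> M22 \<Longrightarrow> p \<in> {1..22} \<Longrightarrow> \<sigma> p \<in> {1..22}"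
  using M22_zero[of \<sigma> p] permutes_in_image[of \<sigma> "{..<23}" p]
  by (auto simp: M22_def Suc_le_eq less_Suc_eq_le)

lemma M22_S4723: "\<sigma> \<in> M22 \<Longrightarrow> B \<in> S4723 \<Longrightarrow> \<sigma> ` B \<in> S4723"
  using card_image[OF inj_on_subset[OF M22_inj], of \<sigma> B] by (auto simp: S4723_def M22_def)

lemma M22_mem_image: "\<sigma> \<in> M22 \<Longrightarrow> \<sigma> p \<in> \<sigma> ` B \<longleftrightarrow> p \<in> B"
  by (simp add: inj_image_mem_iff[OF M22_inj])

lemma M22_zero_mem_image: "\<sigma> \<in> M22 \<Longrightarrow> 0 \<in> \<sigma> ` B \<longleftrightarrow> 0 \<in> B"
  using M22_mem_image[of \<sigma> 0 B] by (simp add: M22_def)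

lemma M22_S3622:
  assumes "\<sigma> \<in> M22" "B \<in> S3622"
  shows "\<sigma> ` B \<in> S3622"
proof -
  from assms(2) obtain C where C: "C \<in> S4723" "0 \<in> C" "B = C - {0}"
    by (auto simp: S3622_def)
  have "\<sigma> ` B = \<sigma> ` C - {0}"
    unfolding C(3) using assms(1) by (simp add: image_set_diff[OF M22_inj] M22_def)
  with C assms(1) show ?thesis
    by (auto simp: S3622_def M22_S4723 M22_zero_mem_image)
qed

locale steiner_graph = finite_graph V adj for V :: "vertex set" and adj +
  assumes act_vertex: "\<sigma> \<in> M22 \<Longrightarrow> v \<in> V \<Longrightarrow> act \<sigma> v \<in> V"
    and act_adj: "\<sigma> \<in> M22 \<Longrightarrow> u \<in> V \<Longrightarrow> v \<in> V \<Longrightarrow> adj (act \<sigma> u) (act \<sigma> v) \<longleftrightarrow> adj u v"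
begin

lemma act_Aut:
  assumes "\<sigma> \<in> M22"
  shows "restrict (act \<sigma>) V \<in> carrier Aut"
proof -
  have "inj_on (act \<sigma>) V" using inj_act[OF M22_inj[OF assms]] by (auto intro: inj_onI)
  moreover have "act \<sigma> ` V \<subseteq> V" using act_vertex[OF assms] by auto
  ultimately have "bij_betw (act \<sigma>) V V"
    using endo_inj_surj[OF finite_vertices] by (auto simp: bij_betw_def)
  then show ?thesis
    using act_adj[OF assms] by (simp add: mem_Aut_iff bij_betw_restrict_eq)
qed

end

text \<open>Elements with this property act as elements of the derived group. Every element of the simple group
  \<open>M\<^bsub>22\<^esub>\<close> is a commutator, so looking for the two factors inside \<open>M\<^bsub>22\<^esub>\<close> is no loss.\<close>

definition M22_commutator :: "(nat \<Rightarrow> nat) \<Rightarrow> bool" where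
  "M22_commutator w \<longleftrightarrow> w \<in> M22 \<and> (\<exists>\<sigma>\<in>M22. \<exists>\<tau>\<in>M22. w \<circ> \<tau> \<circ> \<sigma> = \<sigma> \<circ> \<tau>)"

lemma (in steiner_graph) act_derived:
  assumes "M22_commutator w"
  shows "restrict (act w) V \<in> carrier Aut'"
proof -
  from assms obtain \<sigma> \<tau> where *: "w \<in> M22" "\<sigma> \<in> M22" "\<tau> \<in> M22" "w \<circ> \<tau> \<circ> \<sigma> = \<sigma> \<circ> \<tau>"
    by (auto simp: M22_commutator_def)
  then have "act w (act \<tau> (act \<sigma> v)) = act \<sigma> (act \<tau> v)" for v
    by (metis act_comp)
  with * show ?thesis
    by (intro commutator_mem_derived[OF act_Aut[of \<sigma>] act_Aut[of \<tau>] act_Aut[of w]])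
       (simp_all add: act_vertex)
qed

lemma (in steiner_graph) fused_act:
  assumes "M22_commutator w" "S \<subseteq> V" "\<And>s. s \<in> S \<Longrightarrow> act w s = s" "x \<in> V" "act w x = y"
  shows "fused S x y"
  using assms by (intro fusedI[OF act_derived[OF assms(1)]]) auto

text \<open>One coding of the vertices of both graphs by numbers: 0 is the extra vertex of the Higman--Sims graph,
  and every hexad or block is coded by a number above 22, since it has at least six elements.\<close>

definition vertex_of :: "nat \<Rightarrow> vertex" where
  "vertex_of n = (if n = 0 then Infinity else if n < 23 then Point n else Block (bits n))"

lemma vertex_of_simps:
  "vertex_of 0 = Infinity"
  "vertex_of 1 = Point 1"
  "vertex_of (Suc 0) = Point 1"
  "vertex_of (numeral k) = (if numeral k < (23::nat) then Point (numeral k) else Block (bits (numeral k)))"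
  by (simp_all add: vertex_of_def)

lemma inj_vertex_of: "inj vertex_of"
  by (auto simp: inj_def vertex_of_def bits_eq_iff split: if_splits)

definition moves :: "nat list \<Rightarrow> nat \<Rightarrow> nat \<Rightarrow> bool" where
  "moves as m n \<longleftrightarrow>
     (if m < 23 then n < 23 \<and> (m = 0 \<longleftrightarrow> n = 0) \<and> as ! m = n else 23 \<le> n \<and> relabel as m = n)"

lemma act_vertex_of:
  assumes "golay_perm as" "moves as m n" "m < 2 ^ 23"
  shows "act (perm_of as) (vertex_of m) = vertex_of n"
  using assms perm_of_bits[of m as]
  by (auto simp: moves_def vertex_of_def golay_perm_def perm_of_def split: if_splits)

lemma (in steiner_graph) fused_path:
  assumes gens: "\<And>as. as \<in> set gens \<Longrightarrow> golay_perm as \<and> M22_commutator (perm_of as)"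
    and S: "S \<subseteq> V" "\<And>as s. as \<in> set gens \<Longrightarrow> s \<in> S \<Longrightarrow> act (perm_of as) s = s"
    and path: "successively (\<lambda>m n. \<exists>as\<in>set gens. moves as m n \<or> moves as n m) ns"
    and ns: "vertex_of ` set ns \<subseteq> V" "\<forall>n\<in>set ns. n < 2 ^ 23"
    and mn: "m \<in> set ns" "n \<in> set ns"
  shows "fused S (vertex_of m) (vertex_of n)"
proof -
  have step: "fused S (vertex_of m) (vertex_of n)"
    if "\<exists>as\<in>set gens. moves as m n \<or> moves as n m" "m \<in> set ns" "n \<in> set ns" for m n
  proof -
    have "fused S (vertex_of m) (vertex_of n)"
      if "as \<in> set gens" "moves as m n" "m \<in> set ns" for as m n
      using that gens[OF that(1)] S ns by (intro fused_act[of "perm_of as"] act_vertex_of) auto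
    with that show ?thesis by (metis fused_sym[OF S(1)])
  qed
  have "successively (\<lambda>m n. fused S (vertex_of m) (vertex_of n)) ns"
    by (rule successively_mono[OF path]) (use step in blast)
  then have "successively (fused S) (map vertex_of ns)"
    by (simp add: successively_map)
  from fused_successively[OF S(1) _ this] ns(1) mn show ?thesis by auto
qed

section \<open>Explicit elements of the Mathieu group\<close>

text \<open>Two elements of order 7 that fix 0 and 1 and generate \<open>L\<^sub>3(4)\<close>.\<close>

definition plane_gen :: "nat list" where
  "plane_gen = [
     0, 1, 3, 11, 8, 18, 7, 20, 2, 15, 5, 12, 19, 10, 6, 17, 22, 14, 16, 4, 9, 13, 21]"

definition plane_gen' :: "nat list" where
  "plane_gen' = [
     0, 1, 3, 11, 10, 16, 20, 17, 12, 19, 8, 9, 13, 5, 22, 7, 4, 18, 14, 6, 2, 15, 21]"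

text \<open>An element of order 7 that does not fix the point 1, so that it joins the orbits of \<open>L\<^sub>3(4)\<close> on points and on
  blocks through 0 to orbits of \<open>M\<^bsub>22\<^esub>\<close>.\<close>

definition linker :: "nat list" where
  "linker = [
     0, 3, 2, 11, 1, 20, 9, 15, 19, 5, 16, 8, 4, 6, 22, 18, 13, 7, 21, 12, 10, 14, 17]"

text \<open>Of order 3. It conjugates each of the three elements above to its square, which exhibits them as
  commutators, and it permutes the six vertices that will be shown to be in general position.\<close>

definition rotation :: "nat list" where
  "rotation = [
     0, 1, 2, 11, 12, 16, 9, 17, 4, 20, 5, 19, 8, 13, 7, 15, 10, 14, 21, 3, 6, 22, 18]"

text \<open>An involution that inverts \<open>hexad_mover\<close>.\<close>

definition reflection :: "nat list" where
  "reflection = [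
     0, 4, 19, 8, 1, 14, 6, 7, 3, 21, 10, 12, 11, 15, 5, 13, 16, 17, 18, 2, 22, 9, 20]"

text \<open>The witnesses for general position: an involution and an element of order 3. The first is the
  commutator of \<open>reflection\<close> and \<open>linker\<close>, the second that of \<open>reflection\<close> and itself.\<close>

definition point_mover :: "nat list" where
  "point_mover = [
     0, 8, 11, 4, 3, 5, 18, 7, 1, 21, 17, 2, 19, 15, 14, 13, 16, 10, 6, 12, 20, 9, 22]"

definition hexad_mover :: "nat list" where
  "hexad_mover = [
     0, 15, 1, 8, 19, 5, 11, 22, 18, 21, 10, 12, 6, 4, 14, 2, 16, 9, 3, 13, 7, 17, 20]"

lemma golay_perms:
  "golay_perm plane_gen" "golay_perm plane_gen'" "golay_perm linker" "golay_perm rotation"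
  "golay_perm reflection" "golay_perm point_mover" "golay_perm hexad_mover"
  by (simp_all add: golay_perm_def golay_basis_def plane_gen_def plane_gen'_def linker_def
      rotation_def reflection_def point_mover_def hexad_mover_def)

lemma commutatorI:
  assumes "golay_perm w" "golay_perm r" "golay_perm s" "map ((!) w) (map ((!) s) r) = map ((!) r) s"
  shows "M22_commutator (perm_of w)"
proof -
  have len: "length w = 23" "length r = 23" "length s = 23"
    using assms(1-3) by (simp_all add: golay_perm_def)
  have lt: "r ! i < 23" "s ! i < 23" if "i < 23" for i
    using assms(2,3) that by (auto simp: golay_perm_def list_all_length)
  have "(perm_of w \<circ> perm_of s \<circ> perm_of r) i = (perm_of r \<circ> perm_of s) i" for i
  proof (cases "i < 23")
    case True
    have "w ! (s ! (r ! i)) = r ! (s ! i)"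
      using arg_cong[OF assms(4), of "\<lambda>l. l ! i"] True len by simp
    with True show ?thesis by (simp add: perm_of_def len lt)
  qed (simp add: perm_of_def len)
  then have "perm_of w \<circ> perm_of s \<circ> perm_of r = perm_of r \<circ> perm_of s" by blast
  then show ?thesis
    unfolding M22_commutator_def using assms(1-3)[THEN golay_perm_in_M22] by blast
qed

lemma commutators:
  "M22_commutator (perm_of plane_gen)" "M22_commutator (perm_of plane_gen')"
  "M22_commutator (perm_of linker)"
  "M22_commutator (perm_of hexad_mover)" "M22_commutator (perm_of point_mover)"
proof -
  show "M22_commutator (perm_of plane_gen)"
    by (rule commutatorI[OF golay_perms(1,4,1)]) (simp add: plane_gen_def rotation_def)
  show "M22_commutator (perm_of plane_gen')"
    by (rule commutatorI[OF golay_perms(2,4,2)]) (simp add: plane_gen'_def rotation_def)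
  show "M22_commutator (perm_of linker)"
    by (rule commutatorI[OF golay_perms(3,4,3)]) (simp add: linker_def rotation_def)
  show "M22_commutator (perm_of hexad_mover)"
    by (rule commutatorI[OF golay_perms(7,5,7)]) (simp add: hexad_mover_def reflection_def)
  show "M22_commutator (perm_of point_mover)"
    by (rule commutatorI[OF golay_perms(6,5,3)]) (simp add: point_mover_def reflection_def linker_def)
qed

text \<open>Unfolded on numerals only, like \<open>relabel\<close>; the codes 0 and 1 do not occur in the paths.\<close>

lemma moves_numeral [simp]:
  "moves as (numeral m) (numeral n) \<longleftrightarrow>
     (if numeral m < (23::nat) then numeral n < (23::nat) \<and> as ! numeral m = numeral n
      else (23::nat) \<le> numeral n \<and> relabel as (numeral m) = numeral n)"
  by (simp add: moves_def)

abbreviation linked :: "nat \<Rightarrow> nat \<Rightarrow> bool" where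
  "linked m n \<equiv> \<exists>as\<in>set [plane_gen, plane_gen']. moves as m n \<or> moves as n m"

lemma paths:
  "successively linked points"
  "successively linked lines"
  "successively linked hyperovals"
  "successively linked hyperovals'"
  "successively linked subplanes"
  by (simp_all add: points_def lines_def hyperovals_def hyperovals'_def subplanes_def
      plane_gen_def plane_gen'_def)

context steiner_graph
begin

lemma fused_moves:
  assumes "golay_perm w" "M22_commutator (perm_of w)" "moves w m n" "m < 2 ^ 23"
    and "S \<subseteq> V" "\<And>s. s \<in> S \<Longrightarrow> act (perm_of w) s = s" "vertex_of m \<in> V"
  shows "fused S (vertex_of m) (vertex_of n)"
  using assms by (intro fused_act[of "perm_of w"] act_vertex_of) auto

text \<open>The element used is the conjugate of \<open>w\<close> by \<open>f\<close>; it is evaluated by following \<open>w\<close> between the images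
  under \<open>f\<close>.\<close>

lemma fused_twisted:
  assumes f: "f \<in> carrier Aut" and w: "golay_perm w" "M22_commutator (perm_of w)"
    and S: "S \<subseteq> V" "\<And>s. s \<in> S \<Longrightarrow> act (perm_of w) (f s) = f s"
    and mn: "vertex_of m \<in> V" "vertex_of n \<in> V" "f (vertex_of m) = vertex_of m'"
      "f (vertex_of n) = vertex_of n'" "moves w m' n'" "m' < 2 ^ 23"
  shows "fused S (vertex_of m) (vertex_of n)"
proof (rule fused_conjugate[OF f act_derived[OF w(2)] S(1)])
  show "restrict (act (perm_of w)) V (f s) = f s" if "s \<in> S" for s
    using S that Aut_closed[OF f] by auto
  show "restrict (act (perm_of w)) V (f (vertex_of m)) = f (vertex_of n)"
    using mn Aut_closed[OF f mn(1)] act_vertex_of[OF w(1) mn(5,6)] by simp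
qed (use mn in auto)

lemma fused_plane_path:
  assumes S: "S \<subseteq> V" "S \<subseteq> {Infinity, Point 1}"
    and path: "successively linked ns" and ns: "vertex_of ` set ns \<subseteq> V" "\<forall>n\<in>set ns. n < 2 ^ 23"
    and mn: "m \<in> set ns" "n \<in> set ns"
  shows "fused S (vertex_of m) (vertex_of n)"
proof (rule fused_path[OF _ S(1) _ path ns mn])
  show "golay_perm as \<and> M22_commutator (perm_of as)" if "as \<in> set [plane_gen, plane_gen']" for as
    using that golay_perms(1,2) commutators(1,2) by auto
  show "act (perm_of as) s = s" if "as \<in> set [plane_gen, plane_gen']" "s \<in> S" for as s
    using that S(2) by (auto simp: perm_of_def plane_gen_def plane_gen'_def)
qed

end

section \<open>Six vertices in general position\<close>

context steiner_graph
begin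

lemma moved_alone_moves:
  assumes w: "golay_perm w" "M22_commutator (perm_of w)"
    and ks: "vertex_of ` set ks \<subseteq> V" "\<forall>k\<in>set ks. k < 2 ^ 23"
    and m: "m \<in> set ks" "moves w m n" "n \<noteq> m" and others: "\<forall>k\<in>set ks - {m}. moves w k k"
  shows "moved_alone (vertex_of ` set ks) (vertex_of m)"
proof -
  have "act (perm_of w) (vertex_of m) \<noteq> vertex_of m"
    using act_vertex_of[OF w(1) m(2)] ks m injD[OF inj_vertex_of] by fastforce
  moreover have "act (perm_of w) (vertex_of k) = vertex_of k" if "k \<in> set ks - {m}" for k
    using act_vertex_of[OF w(1), of k k] ks others that by blast
  ultimately show ?thesis
    unfolding moved_alone_def using act_derived[OF w(2)] ks m(1)
    by (intro bexI[of _ "restrict (act (perm_of w)) V"]) auto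
qed

lemma moved_alone_rotate:
  assumes w: "golay_perm w"
    and ks: "vertex_of ` set ks \<subseteq> V" "\<forall>k\<in>set ks. k < 2 ^ 23 \<and> (\<exists>k'\<in>set ks. moves w k k')"
    and m: "m \<in> set ks" "moves w m n" "moved_alone (vertex_of ` set ks) (vertex_of n)"
  shows "moved_alone (vertex_of ` set ks) (vertex_of m)"
proof (rule moved_alone_conjugate[OF act_Aut[OF golay_perm_in_M22[OF w]] ks(1)])
  have "act (perm_of w) (vertex_of k) \<in> vertex_of ` set ks" if "k \<in> set ks" for k
    using act_vertex_of[OF w] ks(2) that by blast
  then show "restrict (act (perm_of w)) V ` vertex_of ` set ks \<subseteq> vertex_of ` set ks"
    using ks(1) by auto
  have "restrict (act (perm_of w)) V (vertex_of m) = vertex_of n"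
    using act_vertex_of[OF w m(2)] ks m(1) by auto
  with m(3) show "moved_alone (vertex_of ` set ks) (restrict (act (perm_of w)) V (vertex_of m))" by simp
qed (use m in simp)

end

text \<open>Three points and three hexads, each hexad containing two of the points. The parameter decides whether the
  point 0 is left out of the hexads, as in the Higman--Sims graph, or kept, as in the McLaughlin graph.\<close>

definition triangle :: "nat \<Rightarrow> nat list" where
  "triangle d = [10, 16, 5, 459968 + d, 2246176 + d, 5324960 + d]"

text \<open>\<open>point_mover\<close> fixes the whole triangle except one point, and \<open>hexad_mover\<close> fixes it except one
  hexad. Since \<open>rotation\<close> permutes the points and the hexads cyclically, these two witnesses give all six.\<close>

lemma (in steiner_graph) triangle_moved_alone:
  assumes V: "vertex_of ` set (triangle d) \<subseteq> V" and d: "d = 0 \<or> d = 1" and x: "x \<in> vertex_of ` set (triangle d)"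
  shows "moved_alone (vertex_of ` set (triangle d)) x"
proof -
  define ks where "ks = triangle d"
  note defs = triangle_def point_mover_def hexad_mover_def rotation_def
  have small: "\<forall>k\<in>set ks. k < 2 ^ 23"
    using d by (auto simp: ks_def defs)
  have rot: "moves rotation 16 10" "moves rotation 5 16" "moves rotation (5324960 + d) (459968 + d)"
    "moves rotation (2246176 + d) (5324960 + d)" "moves rotation 10 5" "moves rotation (459968 + d) (2246176 + d)"
    using d by (auto simp: defs)
  have ks: "\<forall>k\<in>set ks. k < 2 ^ 23 \<and> (\<exists>k'\<in>set ks. moves rotation k k')"
  proof
    fix k assume k: "k \<in> set ks"
    have "\<exists>k'\<in>set ks. moves rotation k k'"
      using k rot unfolding ks_def triangle_def by fastforce
    with small k show "k < 2 ^ 23 \<and> (\<exists>k'\<in>set ks. moves rotation k k')" by blast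
  qed
  note R = moved_alone_rotate[OF golay_perms(4) V[folded ks_def] ks]
  have p: "moved_alone (vertex_of ` set ks) (vertex_of 10)"
    using d by (intro moved_alone_moves[OF golay_perms(6) commutators(5) V[folded ks_def] small, of 10 17])
      (auto simp: ks_def defs)
  have b: "moved_alone (vertex_of ` set ks) (vertex_of (459968 + d))"
    using d by (intro moved_alone_moves[OF golay_perms(7) commutators(4) V[folded ks_def] small, of _ "relabel hexad_mover (459968 + d)"])
      (auto simp: ks_def defs)
  have p2: "moved_alone (vertex_of ` set ks) (vertex_of 16)"
    by (rule R[OF _ rot(1) p]) (simp add: ks_def triangle_def)
  have p3: "moved_alone (vertex_of ` set ks) (vertex_of 5)"
    by (rule R[OF _ rot(2) p2]) (simp add: ks_def triangle_def)
  have b2: "moved_alone (vertex_of ` set ks) (vertex_of (5324960 + d))"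
    by (rule R[OF _ rot(3) b]) (simp add: ks_def triangle_def)
  have b3: "moved_alone (vertex_of ` set ks) (vertex_of (2246176 + d))"
    by (rule R[OF _ rot(4) b2]) (simp add: ks_def triangle_def)
  from x p p2 p3 b b2 b3 show ?thesis
    unfolding ks_def[symmetric] by (auto simp: ks_def triangle_def)
qed

section \<open>Automorphisms from polarities of the plane of order four\<close>

fun same_adj :: "(nat \<Rightarrow> nat \<Rightarrow> bool) \<Rightarrow> (nat \<times> nat) list \<Rightarrow> bool" where
  "same_adj r [] \<longleftrightarrow> True"
| "same_adj r ((m, n) # ps) \<longleftrightarrow> list_all (\<lambda>(m', n'). r m m' = r n n') ps \<and> same_adj r ps"

lemma same_adjD:
  assumes "same_adj r ps" "symp r" "(m, n) \<in> set ps" "(m', n') \<in> set ps" "(m, n) \<noteq> (m', n')"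
  shows "r m m' \<longleftrightarrow> r n n'"
  using assms
proof (induction r ps rule: same_adj.induct)
  case (2 r m\<^sub>0 n\<^sub>0 ps)
  then show ?case by (auto simp: list_all_iff symp_def)
qed simp

text \<open>A permutation of the vertices given by two lists is an automorphism once adjacency agrees on all
  unordered pairs of distinct vertices.\<close>

lemma (in finite_graph) Aut_from_lists:
  fixes v :: "nat \<Rightarrow> 'v"
  assumes V: "V = v ` set ms" "inj v" and dist: "distinct ms" "distinct ns"
    and ns: "length ns = length ms" "list_all (\<lambda>n. n \<in> set ms) ns"
    and adj: "same_adj (\<lambda>m n. adj (v m) (v n)) (zip ms ns)"
    and graph: "symp adj" "\<And>x. x \<in> V \<Longrightarrow> \<not> adj x x"
  shows "\<exists>f\<in>carrier Aut. \<forall>(m, n)\<in>set (zip ms ns). f (v m) = v n"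
proof -
  define f where "f = restrict (\<lambda>x. v (the (map_of (zip ms ns) (inv_into UNIV v x)))) V"
  have f: "f (v m) = v n" if "(m, n) \<in> set (zip ms ns)" for m n
  proof -
    have "map_of (zip ms ns) m = Some n"
      using that dist(1) ns(1) by (simp add: map_of_zip_is_Some map_of_is_SomeI)
    moreover have "v m \<in> V" using that V(1) by (auto dest: set_zip_leftD)
    ultimately show ?thesis by (simp add: f_def inv_f_f[OF V(2)])
  qed
  have pair: "\<exists>m n. (m, n) \<in> set (zip ms ns) \<and> x = v m" if "x \<in> V" for x
  proof -
    from that obtain i where "i < length ms" "x = v (ms ! i)"
      by (auto simp: V(1) in_set_conv_nth)
    then have "(ms ! i, ns ! i) \<in> set (zip ms ns)" using ns(1) by (auto simp: set_zip)
    with \<open>x = v (ms ! i)\<close> show ?thesis by blast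
  qed
  have ns_sub: "set ns \<subseteq> set ms" using ns(2) by (auto simp: list_all_iff)
  have adjf: "adj (f x) (f y) \<longleftrightarrow> adj x y" if xy: "x \<in> V" "y \<in> V" for x y
  proof -
    from xy obtain m n m' n' where mn: "(m, n) \<in> set (zip ms ns)" "x = v m"
      "(m', n') \<in> set (zip ms ns)" "y = v m'"
      using pair by blast
    show ?thesis
    proof (cases "(m, n) = (m', n')")
      case True
      have "v n \<in> V" using mn ns_sub V(1) by (auto dest: set_zip_rightD)
      with True mn xy graph(2) show ?thesis by (auto simp: f)
    next
      case False
      have "symp (\<lambda>m n. adj (v m) (v n))" using graph(1) by (auto simp: symp_def)
      from same_adjD[OF adj this mn(1,3) False] mn show ?thesis by (simp add: f)
    qed
  qed
  have inj: "inj_on f V"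
  proof (rule inj_onI)
    fix x y assume xy: "x \<in> V" "y \<in> V" "f x = f y"
    then obtain m n m' n' where mn: "(m, n) \<in> set (zip ms ns)" "x = v m"
      "(m', n') \<in> set (zip ms ns)" "y = v m'"
      using pair by blast
    with xy(3) have "n = n'" using V(2) by (simp add: f inj_eq)
    with mn(1,3) have "m = m'"
      using dist(2) by (auto simp: set_zip nth_eq_iff_index_eq ns(1))
    with mn show "x = y" by simp
  qed
  have "f ` V \<subseteq> V"
  proof clarify
    fix x assume "x \<in> V"
    then obtain m n where "(m, n) \<in> set (zip ms ns)" "x = v m" using pair by blast
    then show "f x \<in> V" using ns_sub V(1) by (auto simp: f dest: set_zip_rightD)
  qed
  with inj have "bij_betw f V V"
    using endo_inj_surj[OF finite_vertices] by (auto simp: bij_betw_def)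
  then have "f \<in> carrier Aut"
    using adjf by (simp add: mem_Aut_iff f_def)
  with f show ?thesis by blast
qed

lemma blocks_large: "w \<in> set blocks \<Longrightarrow> 23 < w \<and> w < 2 ^ 23"
proof -
  have "list_all (\<lambda>w. 23 < w \<and> w < 2 ^ 23) blocks"
    by (simp add: blocks_def lines_def hyperovals_def hyperovals'_def subplanes_def)
  then show "w \<in> set blocks \<Longrightarrow> 23 < w \<and> w < 2 ^ 23" by (auto simp: list_all_iff)
qed

lemma set_points: "insert 1 (set points) = {1..22}"
proof -
  have "distinct (1 # points)" "list_all (\<lambda>p. 1 \<le> p \<and> p \<le> 22) (1 # points)" "length (1 # points) = 22"
    by (simp_all add: points_def)
  then have "set (1 # points) = {1..22}"
    using distinct_card[of "1 # points"] by (intro card_subset_eq) (auto simp: list_all_iff)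
  then show ?thesis by simp
qed

definition hexads_through_1 :: "nat list" where
  "hexads_through_1 = map (\<lambda>w. w - 1) lines"

definition hexads_avoiding_1 :: "nat list" where
  "hexads_avoiding_1 = map (\<lambda>w. w - 1) hyperovals"

lemma hexads_large: "w \<in> set (hexads_through_1 @ hexads_avoiding_1) \<Longrightarrow> 23 \<le> w \<and> w < 2 ^ 23"
  using blocks_large by (fastforce simp: hexads_through_1_def hexads_avoiding_1_def blocks_def)

definition HS_codes :: "nat list" where
  "HS_codes = 0 # 1 # points @ hexads_through_1 @ hexads_avoiding_1"

definition McL_codes :: "nat list" where
  "McL_codes = 1 # points @ blocks"

lemma parity_blocks: "list_all odd (lines @ hyperovals)" "list_all even (hyperovals' @ subplanes)"
  by (simp_all add: lines_def hyperovals_def hyperovals'_def subplanes_def)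

lemma bits_minus_zero:
  assumes "odd w"
  shows "bits w - {0} = bits (w - 1)"
proof -
  from assms obtain k where "w = Suc (2 * k)" by (metis oddE Suc_eq_plus1)
  then show ?thesis by (auto simp: bits_double_Suc bits_double)
qed

lemma S3622_eq: "S3622 = bits ` set (hexads_through_1 @ hexads_avoiding_1)"
proof -
  have "{B \<in> S4723. 0 \<in> B} = bits ` set (lines @ hyperovals)"
    using parity_blocks by (auto simp: S4723_eq blocks_def bits_def bit_0 list_all_iff)
  then have "S3622 = (\<lambda>w. bits w - {0}) ` set (lines @ hyperovals)"
    by (simp add: S3622_def image_image)
  also have "\<dots> = (\<lambda>w. bits (w - 1)) ` set (lines @ hyperovals)"
    using parity_blocks(1) by (intro image_cong refl bits_minus_zero) (auto simp: list_all_iff)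
  finally show ?thesis
    by (simp add: hexads_through_1_def hexads_avoiding_1_def image_image image_Un)
qed

lemma HS_vertices_eq: "HS_vertices = vertex_of ` set HS_codes"
proof -
  have "vertex_of ` set (hexads_through_1 @ hexads_avoiding_1) = Block ` S3622"
    unfolding S3622_eq image_image
    by (intro image_cong refl) (use hexads_large in \<open>fastforce simp: vertex_of_def\<close>)
  moreover have "vertex_of ` {1..22} = Point ` {1..22}"
    by (auto simp: vertex_of_def)
  moreover have "set HS_codes = insert 0 ({1..22} \<union> set (hexads_through_1 @ hexads_avoiding_1))"
    unfolding set_points[symmetric] HS_codes_def by auto
  ultimately show ?thesis
    unfolding HS_vertices_def by (simp add: vertex_of_simps image_Un Un_assoc del: set_append)
qed

lemma McL_vertices_eq: "McL_vertices = vertex_of ` set McL_codes"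
proof -
  have "vertex_of ` set blocks = Block ` S4723"
    using blocks_large by (force simp: S4723_eq vertex_of_def)
  moreover have "vertex_of ` {1..22} = Point ` {1..22}"
    by (auto simp: vertex_of_def)
  ultimately show ?thesis
    unfolding McL_vertices_def set_points[symmetric] McL_codes_def by auto
qed

text \<open>The images of the vertices in \<open>HS_codes\<close> under an automorphism that comes from a polarity of the plane of
  order 4 on the points 2 to 22. It exchanges \<open>Infinity\<close> with the point 1, each point of the plane with
  the hexad of its polar line, and sends a hyperoval to the hyperoval of those points whose polar lines
  miss it.\<close>

definition HS_polarity :: "nat list" where
  "HS_polarity = [
     1, 0, 1347714, 2786, 1066058, 99366, 4272194, 272130, 3153970, 1769986, 4243986,
     155782, 2261314, 545058, 138258, 567306, 2101774, 5245190, 65946, 786518, 6816898,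
     2443266, 4587562, 19, 21, 11, 3, 2, 22, 18, 16, 13, 10, 5, 20, 9, 15, 12, 8, 4, 17, 14,
     7, 6, 3278984, 1079808, 1082152, 1183844, 803464, 1149008, 13480, 1838112, 7602752,
     2204288, 615440, 4195696, 459968, 5324960, 1050260, 1581504, 332336, 5415936, 2246176,
     319584, 562752, 688304, 1458448, 82756, 4227276, 18492, 268616, 656652, 6488084,
     5079296, 3026944, 6330400, 3719172, 4330368, 45332, 2624272, 5771288, 2359716, 1384460,
     4263432, 2108484, 2687080, 4477956, 207136, 139864, 52608, 2117840, 4868160, 249864,
     428548, 6316296, 596100, 2393112, 4727332, 3216640, 4466832]"

text \<open>The images of the vertices in \<open>McL_codes\<close>. Here the plane consists of the points other than 0 and 2. The
  automorphism fixes the point 2 and exchanges each point of the plane with the block of its polar line.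
  It exchanges the hyperovals through 0 with those through 2, again by taking the points whose polar
  lines miss the given hyperoval, and sends a Baer subplane to the points whose polar lines meet it in a
  line of the subplane.\<close>

definition McL_polarity :: "nat list" where
  "McL_polarity = [
     99367, 786519, 2359717, 4477957, 155783, 4227277, 428549, 3719173, 6488085, 5245191,
     45333, 2101775, 1384461, 4727333, 2, 1050261, 1183845, 2108485, 82757, 596101, 18493,
     656653, 16, 4596036, 5, 10, 7079948, 2384404, 7352452, 1839876, 15, 3146076, 4201044,
     11148, 553036, 1, 2251012, 4735380, 397468, 1329348, 2753220, 5390860, 1714196,
     2626612, 5537844, 3539974, 11, 331028, 6307942, 828548, 999460, 13, 2132118, 4319236,
     4, 20, 9, 3, 2461764, 12, 4886534, 6, 311566, 4522630, 2695430, 7, 19, 5574, 1074468,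
     263788, 210436, 18, 198734, 623132, 1573038, 1134614, 14, 1090118, 3213860, 5833796,
     22, 181332, 4328612, 53924, 2180236, 21, 2269228, 6326020, 276518, 17, 4264236,
     4203550, 131894, 1088524, 73972, 544262, 1278340, 8, 559460, 1376610, 1606930, 1581505,
     362664, 639170, 4408578, 431392, 2159618, 6628384, 3278985, 4868161, 5248546, 803465,
     2164306, 1683488, 2100522, 36986, 2117841, 268617, 3179744, 6316297, 3026945, 1458449,
     90666, 857098, 4235682, 4492354, 499730, 2916898, 7438346, 105218, 107848, 664674,
     1246264, 4466833, 1125506, 4424288, 165514, 1230882, 2853888, 2212144, 139865, 4297872,
     5771289, 1426944, 2298018, 4768808, 7602753, 89184, 591776, 4330369, 4786226, 1079809,
     279730, 2624273, 44592, 3153971, 215696, 1998920, 2648224, 6902272, 2556680, 6053890,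
     6557970, 3451136, 414274, 2237840, 5296448, 919938, 6733952, 841744, 562753, 4719434,
     2177048, 862784, 3366976, 2658696, 4216970, 356736, 2901312, 2492528, 5374162, 319585,
     1589872, 4243987, 22296, 1192202, 1324112, 2110304, 688305, 537234, 2787, 4475680,
     2367690, 4502024, 459969, 249865, 567307, 1725568, 147944, 420872, 713472, 6359488,
     3676226, 794936, 4538456, 4195697, 5802624, 272131, 4272195, 3216641, 4923528, 2148936,
     1657096, 725328, 1183552, 5079297, 2443267, 2261315, 5415937, 5506440, 4263433,
     5113360, 615441, 7359504, 1066059, 207137, 1450656, 6427720, 26962, 2246177, 6292152,
     65947, 4587563, 1055152, 2204289, 6330401, 1347715, 662056, 1118920, 5253224, 5324961,
     5317392, 52609, 3679752, 6816899, 527576, 2393113, 545059, 3314192, 7995680, 1313306,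
     1838113, 4734208, 3428392, 3997840, 13481, 6433282, 6856784, 5707776, 3163010, 4985056,
     1769987, 2687081, 1149009, 4220608, 178368, 4360472, 2768922, 138259, 2367104, 4354096,
     332337, 295888, 1082153, 1106072]"

lemma symp_HS_adj: "symp HS_adj"
proof (rule sympI)
  fix u v assume "HS_adj u v"
  then show "HS_adj v u" by (cases u; cases v) auto
qed

lemma symp_McL_adj: "symp McL_adj"
proof (rule sympI)
  fix u v assume "McL_adj u v"
  then show "McL_adj v u" by (cases u; cases v) (auto simp: Int_commute eq_commute)
qed

lemma bits_disjoint_iff: "bits m \<inter> bits n = {} \<longleftrightarrow> meet m n = 0"
  by (simp add: meet_def)

text \<open>Adjacency of coded vertices, arranged so that all case distinctions about the first vertex are made once
  for a whole row of the adjacency matrix.\<close>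

definition HS_row :: "nat \<Rightarrow> nat \<Rightarrow> bool" where
  "HS_row m =
     (if m = 0 then (\<lambda>n. n \<noteq> 0 \<and> n < 23)
      else if m < 23 then (\<lambda>n. n = 0 \<or> \<not> n < 23 \<and> bit n m)
      else (\<lambda>n. n \<noteq> 0 \<and> (if n < 23 then bit m n else meet m n = 0)))"

definition McL_row :: "nat \<Rightarrow> nat \<Rightarrow> bool" where
  "McL_row m =
     (if m = 0 then (\<lambda>n. False)
      else if m < 23 then (\<lambda>n. \<not> n < 23 \<and> bit n m \<noteq> bit n 0)
      else if bit m 0 then (\<lambda>n. if n < 23 then n \<noteq> 0 \<and> \<not> bit m n
                 else meet m n = (if bit n 0 then 1 else 3))
      else (\<lambda>n. if n < 23 then n \<noteq> 0 \<and> bit m n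
            else meet m n = (if bit n 0 then 3 else 1)))"

lemma HS_row_eq: "HS_row m n \<longleftrightarrow> HS_adj (vertex_of m) (vertex_of n)"
  by (simp add: HS_row_def vertex_of_def bits_disjoint_iff)

lemma McL_row_eq: "McL_row m n \<longleftrightarrow> McL_adj (vertex_of m) (vertex_of n)"
  by (simp add: McL_row_def vertex_of_def meet_def)

lemma HS_row_simps:
  "HS_row 0 = (\<lambda>n. n \<noteq> 0 \<and> n < 23)"
  "HS_row (Suc 0) = (\<lambda>n. n = 0 \<or> \<not> n < 23 \<and> bit n (Suc 0))"
  "HS_row (numeral k) = (if numeral k < (23::nat) then (\<lambda>n. n = 0 \<or> \<not> n < 23 \<and> bit n (numeral k))
     else (\<lambda>n. n \<noteq> 0 \<and> (if n < 23 then bit (numeral k :: nat) n else meet (numeral k) n = 0)))"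
  by (simp_all add: HS_row_def)

lemma McL_row_simps:
  "McL_row (Suc 0) = (\<lambda>n. \<not> n < 23 \<and> bit n (Suc 0) \<noteq> bit n 0)"
  "McL_row (numeral k) = (if numeral k < (23::nat) then (\<lambda>n. \<not> n < 23 \<and> bit n (numeral k) \<noteq> bit n 0)
      else if bit (numeral k :: nat) 0 then (\<lambda>n. if n < 23 then n \<noteq> 0 \<and> \<not> bit (numeral k :: nat) n
        else meet (numeral k) n = (if bit n 0 then Suc 0 else Suc (Suc (Suc 0))))
      else (\<lambda>n. if n < 23 then n \<noteq> 0 \<and> bit (numeral k :: nat) n
        else meet (numeral k) n = (if bit n 0 then Suc (Suc (Suc 0)) else Suc 0)))"
  by (simp_all add: McL_row_def numeral_3_eq_3)

lemma bit_row_simps: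
  "bit (Suc 0) 0" "\<not> bit (Suc 0) (Suc n)" "\<not> bit (Suc 0) (numeral k)"
  "\<not> bit (numeral (num.Bit0 w) :: nat) 0" "bit (numeral (num.Bit1 w) :: nat) 0"
  by (simp_all add: bit_0 bit_Suc flip: One_nat_def)

lemma less_23_simps: "(0::nat) < 23" "Suc 0 < 23"
  by simp_all

lemma numeral_Bit1_minus_1: "numeral (num.Bit1 k) - Suc 0 = numeral (num.Bit0 k)"
  by simp

text \<open>The comparison below runs through tens of thousands of pairs. A minimal set of rewrite rules, used with
  \<open>simp only\<close>, avoids the arithmetic simplification procedures on numerals.\<close>

lemmas polarity_simps =
  append.simps list.map zip_Cons_Cons zip.simps(1) same_adj.simps list.pred_inject prod.case
  HS_row_simps McL_row_simps bit_row_simps bit_numeral_simps bit_numeral_Bit0_Suc_iff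
  bit_numeral_Bit1_Suc_iff pred_numeral_simps BitM.simps numeral_One One_nat_def
  meet_simps_Suc if_True if_False simp_thms nat.inject nat.distinct
  zero_neq_numeral[symmetric] zero_neq_numeral numeral_less_iff less_num_simps le_num_simps less_23_simps
  numeral_Bit1_minus_1 zero_neq_one

lemma McL_polarity_check: "same_adj McL_row (zip McL_codes McL_polarity)"
  by (simp only: McL_codes_def McL_polarity_def points_def blocks_def lines_def hyperovals_def
      hyperovals'_def subplanes_def polarity_simps cong: if_weak_cong)

lemma McL_polarity_length: "length McL_polarity = length McL_codes"
  by (simp add: McL_codes_def McL_polarity_def points_def blocks_def lines_def hyperovals_def
      hyperovals'_def subplanes_def)

lemma McL_polarity_distinct: "distinct McL_codes" "distinct McL_polarity"
  by (simp_all add: McL_codes_def McL_polarity_def points_def blocks_def lines_def hyperovals_def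
      hyperovals'_def subplanes_def)

lemma McL_polarity_subset: "list_all (\<lambda>n. n \<in> set McL_codes) McL_polarity"
  by (simp add: McL_codes_def McL_polarity_def points_def blocks_def lines_def hyperovals_def
      hyperovals'_def subplanes_def)

lemma HS_polarity_check: "same_adj HS_row (zip HS_codes HS_polarity)"
  by (simp only: HS_codes_def HS_polarity_def points_def
      hexads_through_1_def hexads_avoiding_1_def lines_def hyperovals_def polarity_simps
      cong: if_weak_cong)

lemma HS_polarity_distinct:
  "length HS_polarity = length HS_codes" "distinct HS_codes" "distinct HS_polarity"
  "list_all (\<lambda>n. n \<in> set HS_codes) HS_polarity"
  by (simp_all add: HS_codes_def HS_polarity_def points_def
      hexads_through_1_def hexads_avoiding_1_def lines_def hyperovals_def)

text \<open>The places at which \<open>linker\<close> and the polarities join different paths.\<close>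

lemma code_in_list:
  "2786 \<in> set hexads_through_1" "1082152 \<in> set hexads_avoiding_1"
  "2101774 \<in> set (hexads_through_1 @ hexads_avoiding_1)"
  "319584 \<in> set (hexads_through_1 @ hexads_avoiding_1)"
  "99367 \<in> set lines" "2787 \<in> set lines" "13481 \<in> set hyperovals" "1082153 \<in> set hyperovals"
  "1606930 \<in> set hyperovals'" "1714196 \<in> set subplanes"
  "2 \<in> set points" "3 \<in> set points"
  by (simp_all add: points_def lines_def hyperovals_def hyperovals'_def subplanes_def
      hexads_through_1_def hexads_avoiding_1_def)

text \<open>Both graphs are described by incidence, intersections and the point 0, all of which \<open>M\<^bsub>22\<^esub>\<close> preserves.\<close>

interpretation HS_graph: steiner_graph HS_vertices HS_adj
proof
  show "finite HS_vertices" by (simp add: HS_vertices_eq)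
  fix \<sigma> assume \<sigma>: "\<sigma> \<in> M22"
  show "act \<sigma> v \<in> HS_vertices" if "v \<in> HS_vertices" for v
    using that \<sigma> M22_point[OF \<sigma>] M22_S3622[OF \<sigma>] by (auto simp: HS_vertices_def)
  have "\<sigma> ` B \<inter> \<sigma> ` C = {} \<longleftrightarrow> B \<inter> C = {}" for B C
    by (simp flip: image_Int[OF M22_inj[OF \<sigma>]])
  then show "HS_adj (act \<sigma> u) (act \<sigma> v) \<longleftrightarrow> HS_adj u v" for u v
    using \<sigma> by (cases u; cases v) (auto simp: M22_mem_image)
qed

interpretation McL_graph: steiner_graph McL_vertices McL_adj
proof
  show "finite McL_vertices" by (simp add: McL_vertices_eq)
  fix \<sigma> assume \<sigma>: "\<sigma> \<in> M22"
  show "act \<sigma> v \<in> McL_vertices" if "v \<in> McL_vertices" for v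
    using that \<sigma> M22_point[OF \<sigma>] M22_S4723[OF \<sigma>] by (auto simp: McL_vertices_def)
  have "card (\<sigma> ` B \<inter> \<sigma> ` C) = card (B \<inter> C)" for B C
    using card_image[OF inj_on_subset[OF M22_inj[OF \<sigma>] subset_UNIV], of "B \<inter> C"]
    by (simp add: image_Int[OF M22_inj[OF \<sigma>]])
  then show "McL_adj (act \<sigma> u) (act \<sigma> v) \<longleftrightarrow> McL_adj u v" for u v
    using \<sigma> by (cases u; cases v) (auto simp: M22_mem_image M22_zero_mem_image)
qed

section \<open>The Higman--Sims group\<close>

lemma HS_polarity_Aut:
  obtains f where "f \<in> carrier HS_graph.Aut"
    "f (vertex_of 0) = vertex_of 1" "f (vertex_of 2101774) = vertex_of 3"
    "f (vertex_of 2) = vertex_of 567306" "f (vertex_of 319584) = vertex_of 268616"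
proof -
  have "\<not> HS_adj x x" if x: "x \<in> HS_vertices" for x
  proof (cases x)
    case (Block B)
    then obtain C where "C \<in> S4723" "B = C - {0}" using x Block by (auto simp: HS_vertices_def S3622_def)
    then have "card C \<le> Suc (card B)" "card C = 7"
      by (auto simp: S4723_def card_Diff_singleton_if)
    then have "B \<noteq> {}" by auto
    with Block show ?thesis by simp
  qed simp_all
  moreover have "same_adj (\<lambda>m n. HS_adj (vertex_of m) (vertex_of n)) (zip HS_codes HS_polarity)"
    using HS_polarity_check by (simp add: HS_row_eq[abs_def])
  ultimately obtain f where f: "f \<in> carrier HS_graph.Aut"
      "\<forall>(m, n)\<in>set (zip HS_codes HS_polarity). f (vertex_of m) = vertex_of n"
    using HS_graph.Aut_from_lists[OF HS_vertices_eq inj_vertex_of HS_polarity_distinct(2,3,1,4) _ symp_HS_adj]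
    by blast
  have sub: "{(0, 1), (2101774, 3), (2, 567306), (319584, 268616)} \<subseteq> set (zip HS_codes HS_polarity)"
    by (simp add: HS_codes_def HS_polarity_def points_def hexads_through_1_def hexads_avoiding_1_def
        lines_def hyperovals_def)
  have ev: "f (vertex_of m) = vertex_of n" if "(m, n) \<in> set (zip HS_codes HS_polarity)" for m n
    using f(2) that by blast
  from sub have "f (vertex_of 0) = vertex_of 1" "f (vertex_of 2101774) = vertex_of 3"
    "f (vertex_of 2) = vertex_of 567306" "f (vertex_of 319584) = vertex_of 268616"
    by (auto intro!: ev)
  with f(1) show ?thesis by (intro that[of f]) simp_all
qed

lemma HS_code_vertex: "n \<in> set HS_codes \<Longrightarrow> vertex_of n \<in> HS_vertices"
  by (simp add: HS_vertices_eq)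

lemma HS_hexad_paths: "successively linked hexads_through_1" "successively linked hexads_avoiding_1"
  by (simp_all add: hexads_through_1_def hexads_avoiding_1_def lines_def hyperovals_def
      plane_gen_def plane_gen'_def)

lemma HS_codes_less: "n \<in> set HS_codes \<Longrightarrow> n < 2 ^ 23"
proof -
  have "list_all (\<lambda>n. n < 23) points" by (simp add: points_def)
  then show "n \<in> set HS_codes \<Longrightarrow> n < 2 ^ 23"
    using hexads_large by (auto simp: HS_codes_def list_all_iff)
qed

text \<open>The path covers the points 2 to 22, and \<open>linker\<close> takes 1 to 3.\<close>

lemma HS_fused_points:
  assumes "n \<in> insert 1 (set points)"
  shows "HS_graph.fused {Infinity} (vertex_of 3) (vertex_of n)"
proof -
  have inf: "{Infinity} \<subseteq> HS_vertices" by (simp add: HS_vertices_def)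
  show ?thesis
  proof (cases "n = 1")
    case True
    have "HS_graph.fused {Infinity} (vertex_of 1) (vertex_of 3)"
      by (rule HS_graph.fused_moves[OF golay_perms(3) commutators(3)])
        (use inf in \<open>auto simp: linker_def moves_def HS_vertices_def vertex_of_simps\<close>)
    with True show ?thesis using HS_graph.fused_sym[OF inf] by blast
  next
    case False
    show ?thesis
    proof (rule HS_graph.fused_plane_path[OF inf _ paths(1)])
      show "vertex_of ` set points \<subseteq> HS_vertices" "\<forall>n\<in>set points. n < 2 ^ 23"
        using HS_code_vertex HS_codes_less by (auto simp: HS_codes_def)
    qed (use code_in_list assms False in auto)
  qed
qed

text \<open>\<open>linker\<close> takes a hexad through 1 to a hexad avoiding 1.\<close>

lemma HS_fused_hexads:
  assumes "n \<in> set (hexads_through_1 @ hexads_avoiding_1)"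
  shows "HS_graph.fused {Infinity} (vertex_of 2786) (vertex_of n)"
proof -
  have inf: "{Infinity} \<subseteq> HS_vertices" by (simp add: HS_vertices_def)
  have path: "HS_graph.fused {Infinity} (vertex_of m) (vertex_of n)"
    if "ns \<in> {hexads_through_1, hexads_avoiding_1}" "m \<in> set ns" "n \<in> set ns" for ns m n
  proof (rule HS_graph.fused_plane_path[OF inf])
    show "successively linked ns" using that HS_hexad_paths by auto
    have sub: "set ns \<subseteq> set HS_codes" using that(1) by (auto simp: HS_codes_def)
    then show "vertex_of ` set ns \<subseteq> HS_vertices" "\<forall>n\<in>set ns. n < 2 ^ 23"
      using HS_code_vertex HS_codes_less by auto
  qed (use that in auto)
  have "vertex_of 2786 \<in> HS_vertices"
    by (rule HS_code_vertex) (use code_in_list(1) in \<open>simp add: HS_codes_def\<close>)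
  then have link: "HS_graph.fused {Infinity} (vertex_of 2786) (vertex_of 1082152)"
    by (intro HS_graph.fused_moves[OF golay_perms(3) commutators(3)])
      (use inf in \<open>auto simp: linker_def\<close>)
  from assms consider "n \<in> set hexads_through_1" | "n \<in> set hexads_avoiding_1"
    by auto
  then show ?thesis
  proof cases
    case 1
    then show ?thesis using path[of "hexads_through_1" 2786 n] code_in_list(1) by blast
  next
    case 2
    then have "HS_graph.fused {Infinity} (vertex_of 1082152) (vertex_of n)"
      using path[of "hexads_avoiding_1" 1082152 n] code_in_list(2) by blast
    with link show ?thesis by (rule HS_graph.fused_trans[OF inf])
  qed
qed

lemma HS_vertex_cases:
  assumes "v \<in> HS_vertices"
  obtains "v = Infinity"
  | n where "v = vertex_of n" "n \<in> insert 1 (set points)" "HS_adj Infinity v"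
  | n where "v = vertex_of n" "n \<in> set (hexads_through_1 @ hexads_avoiding_1)" "\<not> HS_adj Infinity v"
proof -
  from assms obtain n where n: "v = vertex_of n" "n \<in> set HS_codes" by (auto simp: HS_vertices_eq)
  have hex: "\<not> HS_adj Infinity (vertex_of w)" if "w \<in> set (hexads_through_1 @ hexads_avoiding_1)" for w
    using hexads_large[OF that] by (simp add: vertex_of_def)
  have pt: "HS_adj Infinity (vertex_of w)" if "w \<in> insert 1 (set points)" for w
    using that unfolding set_points by (simp add: vertex_of_def)
  consider "n = 0" | "n \<in> insert 1 (set points)" | "n \<in> set (hexads_through_1 @ hexads_avoiding_1)"
    using n(2) by (auto simp: HS_codes_def)
  then show ?thesis
  proof cases
    case 1
    with n(1) show ?thesis by (intro that(1)) (simp add: vertex_of_simps)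
  next
    case 2
    with n(1) pt show ?thesis by (intro that(2)) blast+
  next
    case 3
    with n(1) hex show ?thesis by (intro that(3)) blast+
  qed
qed

lemma HS_rank_three: "HS_graph.rank_three_at Infinity"
  unfolding HS_graph.rank_three_at_def
proof (intro conjI ballI impI)
  have inf: "{Infinity} \<subseteq> HS_vertices" by (simp add: HS_vertices_def)
  show "Infinity \<in> HS_vertices" by (simp add: HS_vertices_def)
  fix x y assume xy: "x \<in> HS_vertices" "y \<in> HS_vertices"
    "x \<noteq> Infinity \<and> y \<noteq> Infinity \<and> (HS_adj Infinity x \<longleftrightarrow> HS_adj Infinity y)"
  show "HS_graph.fused {Infinity} x y"
  proof (cases "HS_adj Infinity x")
    case True
    then have "x \<in> vertex_of ` insert 1 (set points)" "y \<in> vertex_of ` insert 1 (set points)"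
      using xy by (auto elim!: HS_vertex_cases)
    from HS_graph.fused_hub[OF inf _ this, of "vertex_of 3"] HS_fused_points show ?thesis by blast
  next
    case False
    then have "x \<in> vertex_of ` set (hexads_through_1 @ hexads_avoiding_1)"
      "y \<in> vertex_of ` set (hexads_through_1 @ hexads_avoiding_1)"
      using xy by (auto elim!: HS_vertex_cases)
    from HS_graph.fused_hub[OF inf _ this, of "vertex_of 2786"] HS_fused_hexads show ?thesis by blast
  qed
next
  \<comment> \<open>The code 2786 stands for the hexad \<open>{1, 5, 6, 7, 9, 11}\<close>, which contains 1 but not 2.\<close>
  have "vertex_of 2786 \<in> HS_vertices" "vertex_of 1 \<in> HS_vertices" "vertex_of 2 \<in> HS_vertices"
    by (rule HS_code_vertex; use code_in_list in \<open>simp add: HS_codes_def\<close>)+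
  then have v: "Block (bits 2786) \<in> HS_vertices" "Point 1 \<in> HS_vertices" "Point 2 \<in> HS_vertices"
    by (simp_all add: vertex_of_simps)
  then show "\<exists>b\<in>HS_vertices. \<exists>x\<in>HS_vertices. b \<noteq> Infinity \<and> HS_adj Infinity b \<and>
      x \<noteq> Infinity \<and> \<not> HS_adj Infinity x \<and> x \<noteq> b \<and> HS_adj b x"
    by (intro bexI[of _ "Point 1"] bexI[of _ "Block (bits 2786)"]) simp_all
  from v show "\<exists>c\<in>HS_vertices. \<exists>y\<in>HS_vertices. c \<noteq> Infinity \<and> \<not> HS_adj Infinity c \<and>
      y \<noteq> Infinity \<and> HS_adj Infinity y \<and> y \<noteq> c \<and> \<not> HS_adj c y"
    by (intro bexI[of _ "Point 2"] bexI[of _ "Block (bits 2786)"]) simp_all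
qed

text \<open>\<open>M\<^bsub>22\<^esub>\<close> has the orbits \<open>{Infinity}\<close>, the points and the hexads; the conjugate of \<open>linker\<close> by the
  polarity joins \<open>Infinity\<close> to a hexad and a hexad to a point.\<close>

lemma HS_transitive:
  assumes "v \<in> HS_vertices"
  shows "HS_graph.fused {} Infinity v"
proof -
  obtain f where f: "f \<in> carrier HS_graph.Aut"
    "f (vertex_of 0) = vertex_of 1" "f (vertex_of 2101774) = vertex_of 3"
    "f (vertex_of 2) = vertex_of 567306" "f (vertex_of 319584) = vertex_of 268616"
    by (rule HS_polarity_Aut)
  have V: "vertex_of 0 \<in> HS_vertices" "vertex_of 2101774 \<in> HS_vertices" "vertex_of 2 \<in> HS_vertices"
    "vertex_of 319584 \<in> HS_vertices"
    by (rule HS_code_vertex; use code_in_list in \<open>auto simp: HS_codes_def\<close>)+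
  note tr = HS_graph.fused_trans[OF empty_subsetI]
    and sy = HS_graph.fused_sym[OF empty_subsetI]
    and up = HS_graph.fused_mono[OF _ empty_subsetI]
  \<comment> \<open>The polarity takes \<open>Infinity\<close> to 1, \<open>linker\<close> takes 1 to 3, and 3 is the image of the hexad 2101774.\<close>
  have a: "HS_graph.fused {} (vertex_of 0) (vertex_of 2101774)"
    by (rule HS_graph.fused_twisted[OF f(1) golay_perms(3) commutators(3), of _ _ _ 1 3])
      (use f V in \<open>simp_all add: linker_def moves_def\<close>)
  \<comment> \<open>The image 567306 of 2 is a line, which \<open>linker\<close> takes to the hyperoval 268616, the image of 319584.\<close>
  have b: "HS_graph.fused {} (vertex_of 2) (vertex_of 319584)"
    by (rule HS_graph.fused_twisted[OF f(1) golay_perms(3) commutators(3), of _ _ _ 567306 268616])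
      (use f V in \<open>simp_all add: linker_def\<close>)
  have hex: "HS_graph.fused {} Infinity (vertex_of n)"
    if "n \<in> set (hexads_through_1 @ hexads_avoiding_1)" for n
    using tr[OF a tr[OF sy[OF up[OF HS_fused_hexads[OF code_in_list(3)]]] up[OF HS_fused_hexads[OF that]]]]
    by (simp add: vertex_of_simps)
  have pt: "HS_graph.fused {} Infinity (vertex_of n)" if "n \<in> insert 1 (set points)" for n
  proof -
    have "2 \<in> insert 1 (set points)" using code_in_list by simp
    from tr[OF tr[OF hex[OF code_in_list(4)] sy[OF b]]
        tr[OF sy[OF up[OF HS_fused_points[OF this]]] up[OF HS_fused_points[OF that]]]]
    show ?thesis .
  qed
  from assms show ?thesis
  proof (cases rule: HS_vertex_cases)
    case 1
    then show ?thesis using HS_graph.fused_refl[of Infinity "{}"] assms by simp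
  qed (use hex pt in auto)
qed

lemma MaxDim_HS: "MaxDim HS \<ge> 6"
proof -
  have "set (triangle 0) \<subseteq> set HS_codes"
    by (simp add: triangle_def HS_codes_def points_def hexads_through_1_def hexads_avoiding_1_def
        lines_def hyperovals_def)
  then have V: "vertex_of ` set (triangle 0) \<subseteq> HS_vertices"
    using HS_code_vertex by blast
  have "length (map vertex_of (triangle 0)) \<le> MaxDim HS_graph.Aut'"
  proof (rule HS_graph.MaxDim_ge_stabilisers[OF HS_rank_three HS_transitive])
    show "distinct (map vertex_of (triangle 0))"
      unfolding distinct_map by (intro conjI inj_on_subset[OF inj_vertex_of]) (simp_all add: triangle_def)
  qed (use V HS_graph.triangle_moved_alone[OF V] in auto)
  then show ?thesis by (simp add: HS_def triangle_def)
qed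

section \<open>The McLaughlin group\<close>

lemma McL_polarity_Aut:
  obtains f where "f \<in> carrier McL_graph.Aut"
    "f (vertex_of 1) = vertex_of 99367" "f (vertex_of 99367) = vertex_of 1"
    "f (vertex_of 2) = vertex_of 2" "f (vertex_of 3) = vertex_of 1050261" "f (vertex_of 1714196) = vertex_of 6816899"
    "f (vertex_of 13481) = vertex_of 999460" "f (vertex_of 1606930) = vertex_of 90666"
proof -
  have "\<not> McL_adj x x" if "x \<in> McL_vertices" for x
    using that by (cases x) (auto simp: McL_vertices_def S4723_def)
  moreover have "same_adj (\<lambda>m n. McL_adj (vertex_of m) (vertex_of n)) (zip McL_codes McL_polarity)"
    using McL_polarity_check by (simp add: McL_row_eq[abs_def])
  ultimately obtain f where f: "f \<in> carrier McL_graph.Aut"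
      "\<forall>(m, n)\<in>set (zip McL_codes McL_polarity). f (vertex_of m) = vertex_of n"
    using McL_graph.Aut_from_lists[OF McL_vertices_eq inj_vertex_of McL_polarity_distinct
        McL_polarity_length McL_polarity_subset _ symp_McL_adj]
    by blast
  have sub: "{(1, 99367), (99367, 1), (2, 2), (3, 1050261), (1714196, 6816899), (13481, 999460), (1606930, 90666)}
      \<subseteq> set (zip McL_codes McL_polarity)"
    by (simp add: McL_codes_def McL_polarity_def points_def blocks_def lines_def hyperovals_def
        hyperovals'_def subplanes_def)
  have ev: "f (vertex_of m) = vertex_of n" if "(m, n) \<in> set (zip McL_codes McL_polarity)" for m n
    using f(2) that by blast
  from sub have "f (vertex_of 1) = vertex_of 99367" "f (vertex_of 99367) = vertex_of 1"
    "f (vertex_of 2) = vertex_of 2" "f (vertex_of 3) = vertex_of 1050261"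
    "f (vertex_of 1714196) = vertex_of 6816899" "f (vertex_of 13481) = vertex_of 999460"
    "f (vertex_of 1606930) = vertex_of 90666"
    by (auto intro!: ev)
  with f(1) show ?thesis by (intro that[of f]) simp_all
qed

lemma McL_code_vertex: "n \<in> set McL_codes \<Longrightarrow> vertex_of n \<in> McL_vertices"
  by (simp add: McL_vertices_eq)

lemma McL_codes_less: "n \<in> set McL_codes \<Longrightarrow> n < 2 ^ 23"
proof -
  have "list_all (\<lambda>n. n < 23) points" by (simp add: points_def)
  then show "n \<in> set McL_codes \<Longrightarrow> n < 2 ^ 23"
    using blocks_large by (fastforce simp: McL_codes_def list_all_iff)
qed

lemma Point_1_McL: "{Point 1} \<subseteq> McL_vertices"
  by (simp add: McL_vertices_def)

lemma McL_fused_path: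
  assumes "ns \<in> {points, lines, hyperovals, hyperovals', subplanes}" "m \<in> set ns" "n \<in> set ns"
  shows "McL_graph.fused {Point 1} (vertex_of m) (vertex_of n)"
proof (rule McL_graph.fused_plane_path[OF Point_1_McL])
  show "successively linked ns" using assms(1) paths by auto
  have sub: "set ns \<subseteq> set McL_codes" using assms(1) by (auto simp: McL_codes_def blocks_def)
  then show "vertex_of ` set ns \<subseteq> McL_vertices" "\<forall>n\<in>set ns. n < 2 ^ 23"
    using McL_code_vertex McL_codes_less by auto
qed (use assms in auto)

text \<open>\<open>L\<^sub>3(4)\<close> has five orbits on the vertices other than the point 1. The polarity at the point 2 takes the
  point 1 to a line fixed by \<open>hexad_mover\<close>, so the conjugate of \<open>hexad_mover\<close> fixes the point 1; it joins
  the five orbits into two.\<close>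

lemma McL_links:
  "McL_graph.fused {Point 1} (vertex_of 99367) (vertex_of 2)"
  "McL_graph.fused {Point 1} (vertex_of 3) (vertex_of 1714196)"
  "McL_graph.fused {Point 1} (vertex_of 13481) (vertex_of 1606930)"
proof -
  obtain f where f: "f \<in> carrier McL_graph.Aut"
    "f (vertex_of 1) = vertex_of 99367" "f (vertex_of 99367) = vertex_of 1"
    "f (vertex_of 2) = vertex_of 2" "f (vertex_of 3) = vertex_of 1050261" "f (vertex_of 1714196) = vertex_of 6816899"
    "f (vertex_of 13481) = vertex_of 999460" "f (vertex_of 1606930) = vertex_of 90666"
    by (rule McL_polarity_Aut)
  have fix1: "act (perm_of hexad_mover) (f s) = f s" if "s \<in> {Point 1}" for s
    using that f(2) act_vertex_of[OF golay_perms(7), of 99367 99367]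
    by (simp add: hexad_mover_def vertex_of_simps(2,3))
  note tw = McL_graph.fused_twisted[OF f(1) golay_perms(7) commutators(4) Point_1_McL fix1]
  have V: "vertex_of n \<in> McL_vertices" if "n \<in> {2, 3, 99367, 1714196, 13481, 1606930}" for n
    using that code_in_list by (intro McL_code_vertex) (auto simp: McL_codes_def blocks_def)
  show "McL_graph.fused {Point 1} (vertex_of 99367) (vertex_of 2)"
    by (rule McL_graph.fused_sym[OF Point_1_McL], rule tw[of _ _ 2 1])
      (use f V in \<open>auto simp: hexad_mover_def moves_def\<close>)
  show "McL_graph.fused {Point 1} (vertex_of 3) (vertex_of 1714196)"
    by (rule tw[of _ _ 1050261 6816899]) (use f V in \<open>auto simp: hexad_mover_def\<close>)
  show "McL_graph.fused {Point 1} (vertex_of 13481) (vertex_of 1606930)"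
    by (rule tw[of _ _ 999460 90666]) (use f V in \<open>auto simp: hexad_mover_def\<close>)
qed

lemma McL_fused_nonneighbours:
  assumes "n \<in> set (points @ lines @ subplanes)"
  shows "McL_graph.fused {Point 1} (vertex_of 99367) (vertex_of n)"
proof -
  note tr = McL_graph.fused_trans[OF Point_1_McL]
  have pt: "McL_graph.fused {Point 1} (vertex_of 99367) (vertex_of n)" if "n \<in> set points" for n
    by (rule tr[OF McL_links(1) McL_fused_path[of points]]) (use code_in_list that in auto)
  from assms consider "n \<in> set points" | "n \<in> set lines" | "n \<in> set subplanes" by auto
  then show ?thesis
  proof cases
    case 2
    then show ?thesis using McL_fused_path[of lines] code_in_list by auto
  next
    case 3
    then show ?thesis
      using tr[OF tr[OF pt[OF code_in_list(12)] McL_links(2)] McL_fused_path[of subplanes]] code_in_list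
      by auto
  qed (rule pt)
qed

lemma McL_fused_neighbours:
  assumes "n \<in> set (hyperovals @ hyperovals')"
  shows "McL_graph.fused {Point 1} (vertex_of 13481) (vertex_of n)"
proof -
  from assms consider "n \<in> set hyperovals" | "n \<in> set hyperovals'" by auto
  then show ?thesis
  proof cases
    case 1
    then show ?thesis using McL_fused_path[of hyperovals] code_in_list by auto
  next
    case 2
    then show ?thesis
      using McL_graph.fused_trans[OF Point_1_McL McL_links(3) McL_fused_path[of hyperovals']] code_in_list
      by auto
  qed
qed

lemma McL_vertex_cases:
  assumes "v \<in> McL_vertices"
  obtains "v = Point 1"
  | n where "v = vertex_of n" "n \<in> set (hyperovals @ hyperovals')" "McL_adj (Point 1) v"
  | n where "v = vertex_of n" "n \<in> set (points @ lines @ subplanes)" "\<not> McL_adj (Point 1) v"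
proof -
  from assms obtain n where n: "v = vertex_of n" "n \<in> set McL_codes" by (auto simp: McL_vertices_eq)
  have adj1: "list_all (McL_row (Suc 0)) (hyperovals @ hyperovals')"
    by (simp add: hyperovals_def hyperovals'_def McL_row_simps)
  have adj0: "list_all (\<lambda>n. \<not> McL_row (Suc 0) n) (points @ lines @ subplanes)"
    by (simp add: points_def lines_def subplanes_def McL_row_simps)
  have adj: "McL_adj (Point 1) (vertex_of n) \<longleftrightarrow> McL_row (Suc 0) n" for n
    by (simp add: McL_row_eq vertex_of_simps)
  consider "n = 1" | "n \<in> set (hyperovals @ hyperovals')" | "n \<in> set (points @ lines @ subplanes)"
    using n(2) by (auto simp: McL_codes_def blocks_def)
  then show ?thesis
  proof cases
    case 1
    with n(1) show ?thesis by (intro that(1)) (simp add: vertex_of_simps)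
  next
    case 2
    with n(1) adj adj1 show ?thesis by (intro that(2)) (auto simp: list_all_iff)
  next
    case 3
    with n(1) adj adj0 show ?thesis by (intro that(3)) (auto simp: list_all_iff)
  qed
qed

lemma McL_rank_three: "McL_graph.rank_three_at (Point 1)"
  unfolding McL_graph.rank_three_at_def
proof (intro conjI ballI impI)
  show "Point 1 \<in> McL_vertices" using Point_1_McL by simp
  fix x y assume xy: "x \<in> McL_vertices" "y \<in> McL_vertices"
    "x \<noteq> Point 1 \<and> y \<noteq> Point 1 \<and> (McL_adj (Point 1) x \<longleftrightarrow> McL_adj (Point 1) y)"
  show "McL_graph.fused {Point 1} x y"
  proof (cases "McL_adj (Point 1) x")
    case True
    then have "x \<in> vertex_of ` set (hyperovals @ hyperovals')" "y \<in> vertex_of ` set (hyperovals @ hyperovals')"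
      using xy by (auto elim!: McL_vertex_cases)
    from McL_graph.fused_hub[OF Point_1_McL _ this, of "vertex_of 13481"] McL_fused_neighbours
    show ?thesis by blast
  next
    case False
    then have "x \<in> vertex_of ` set (points @ lines @ subplanes)"
      "y \<in> vertex_of ` set (points @ lines @ subplanes)"
      using xy by (auto elim!: McL_vertex_cases)
    from McL_graph.fused_hub[OF Point_1_McL _ this, of "vertex_of 99367"] McL_fused_nonneighbours
    show ?thesis by blast
  qed
next
  \<comment> \<open>The code 13481 stands for the block \<open>{0, 3, 5, 7, 10, 12, 13}\<close>, which contains 0 and 3 but not 1 or 2.\<close>
  have "vertex_of 13481 \<in> McL_vertices" "vertex_of 2 \<in> McL_vertices" "vertex_of 3 \<in> McL_vertices"
    by (rule McL_code_vertex; use code_in_list in \<open>simp add: McL_codes_def blocks_def\<close>)+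
  then have v: "Block (bits 13481) \<in> McL_vertices" "Point 2 \<in> McL_vertices" "Point 3 \<in> McL_vertices"
    by (simp_all add: vertex_of_simps)
  then show "\<exists>b\<in>McL_vertices. \<exists>x\<in>McL_vertices. b \<noteq> Point 1 \<and> McL_adj (Point 1) b \<and>
      x \<noteq> Point 1 \<and> \<not> McL_adj (Point 1) x \<and> x \<noteq> b \<and> McL_adj b x"
    by (intro bexI[of _ "Block (bits 13481)"] bexI[of _ "Point 2"]) simp_all
  from v show "\<exists>c\<in>McL_vertices. \<exists>y\<in>McL_vertices. c \<noteq> Point 1 \<and> \<not> McL_adj (Point 1) c \<and>
      y \<noteq> Point 1 \<and> McL_adj (Point 1) y \<and> y \<noteq> c \<and> \<not> McL_adj c y"
    by (intro bexI[of _ "Point 3"] bexI[of _ "Block (bits 13481)"]) simp_all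
qed

text \<open>The three orbits of the stabiliser of the point 1 are already joined by \<open>M\<^bsub>22\<^esub>\<close>.\<close>

lemma McL_transitive:
  assumes "v \<in> McL_vertices"
  shows "McL_graph.fused {} (Point 1) v"
proof -
  note tr = McL_graph.fused_trans[OF empty_subsetI]
    and sy = McL_graph.fused_sym[OF empty_subsetI]
    and up = McL_graph.fused_mono[OF _ empty_subsetI]
  have V: "vertex_of 1 \<in> McL_vertices" "vertex_of 2787 \<in> McL_vertices"
    by (rule McL_code_vertex; use code_in_list in \<open>simp add: McL_codes_def blocks_def\<close>)+
  have a: "McL_graph.fused {} (vertex_of 1) (vertex_of 3)"
    by (rule McL_graph.fused_moves[OF golay_perms(3) commutators(3)])
      (use V in \<open>auto simp: linker_def moves_def\<close>)
  have b: "McL_graph.fused {} (vertex_of 2787) (vertex_of 1082153)"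
    by (rule McL_graph.fused_moves[OF golay_perms(3) commutators(3)])
      (use V in \<open>auto simp: linker_def\<close>)
  have non: "McL_graph.fused {} (Point 1) (vertex_of n)" if "n \<in> set (points @ lines @ subplanes)" for n
  proof -
    have "3 \<in> set (points @ lines @ subplanes)" using code_in_list by simp
    from tr[OF a tr[OF sy[OF up[OF McL_fused_nonneighbours[OF this]]] up[OF McL_fused_nonneighbours[OF that]]]]
    show ?thesis by (simp add: vertex_of_simps(2,3))
  qed
  have nb: "McL_graph.fused {} (Point 1) (vertex_of n)" if "n \<in> set (hyperovals @ hyperovals')" for n
  proof -
    have "2787 \<in> set (points @ lines @ subplanes)" "1082153 \<in> set (hyperovals @ hyperovals')"
      using code_in_list by simp_all
    from tr[OF tr[OF non[OF this(1)] b]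
        tr[OF sy[OF up[OF McL_fused_neighbours[OF this(2)]]] up[OF McL_fused_neighbours[OF that]]]]
    show ?thesis .
  qed
  from assms show ?thesis
  proof (cases rule: McL_vertex_cases)
    case 1
    then show ?thesis using McL_graph.fused_refl[of "Point 1" "{}"] assms by simp
  qed (use nb non in auto)
qed

lemma MaxDim_McL: "MaxDim McL \<ge> 6"
proof -
  have "set (triangle 1) \<subseteq> set McL_codes"
    by (simp add: triangle_def McL_codes_def points_def blocks_def lines_def hyperovals_def
        hyperovals'_def subplanes_def)
  then have V: "vertex_of ` set (triangle 1) \<subseteq> McL_vertices"
    using McL_code_vertex by blast
  have "length (map vertex_of (triangle 1)) \<le> MaxDim McL_graph.Aut'"
  proof (rule McL_graph.MaxDim_ge_stabilisers[OF McL_rank_three McL_transitive])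
    show "distinct (map vertex_of (triangle 1))"
      unfolding distinct_map by (intro conjI inj_on_subset[OF inj_vertex_of]) (simp_all add: triangle_def)
  qed (use V McL_graph.triangle_moved_alone[OF V] in auto)
  then show ?thesis by (simp add: McL_def triangle_def)
qed

theorem proposition8:
  shows "MaxDim HS \<ge> 6 \<and> MaxDim McL \<ge> 6"
  using MaxDim_HS MaxDim_McL by simp

end
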